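(* Consider the game of randomized prediction under imperfect monitoring with random feedback signals depending only on the outcome, and the block forecaster with parameters $m,\eta$ described in the context. For all integers $m\ge1$, for all $\eta>0$, and for all $\delta>0$, the regret of this forecaster for any strategy of the environment is bounded, with probability at least $1-(n/m+1)\delta$, by $$R_n\le 2\sqrt2\,L\,\frac{1}{\sqrt m}\sqrt{\ln\frac2\delta}+\frac{m\ln N}{n\eta}+\frac{K^2\eta}{2}+\frac mn+\sqrt{\frac1{2n}\ln\frac1\delta},$$ where $K\le1$ and $L$ are constants that depend only on the parameters of the game. The choices $m=\lceil\sqrt n\,\rceil$ and $\eta\sim\sqrt{(m\ln N)/n}$ imply $R_n=O\!\left(n^{-1/4}\sqrt{\ln(nN/\delta)}\right)$ with probability at least $1-\delta$.
   Context: **Game.** Fix integers $N,M\ge1$, a reward function $r:\{1,\dots,N\}\times\{1,\dots,M\}\to[0,1]$, a finite set $\mathcal S$ of signals, and a random feedback function $H:\{1,\dots,M\}\to\mathcal P(\mathcal S)$, where $\mathcal P(\mathcal S)\subset\mathbb R^{|\mathcal S|}$ is the set of probability distributions on $\mathcal S$; all are known to the forecaster. At each round $t=1,\dots,n$: (1) the environment chooses $J_t\in\{1,\dots,M\}$ without revealing it; (2) the forecaster chooses a probability distribution $\boldsymbol p_t$ on $\{1,\dots,N\}$ and draws $I_t$ according to it; (3) the forecaster gets reward $r(I_t,J_t)$, which is not revealed; (4) a signal $s_t$, drawn according to $H(J_t)$ using external independent randomization, is revealed to the forecaster. The environment may use a possibly randomized strategy reacting to the past of the game; $J_t$ is chosen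 before $I_t$ and $s_t$ are drawn, and, given the past and $J_t$, $I_t$ has law $\boldsymbol p_t$. Probabilities are with respect to all randomizations. **Notation.** For probability distributions $\boldsymbol p$ on $\{1,\dots,N\}$ and $\boldsymbol q$ on $\{1,\dots,M\}$, $r(\boldsymbol p,\boldsymbol q)=\sum_{i,j}p_iq_jr(i,j)$ and $H(\boldsymbol q)=\sum_jq_jH(j)$. Let $\mathcal F=\{H(\boldsymbol q)\}\subset\mathcal P(\mathcal S)$, with $\boldsymbol q$ ranging over all distributions on $\{1,\dots,M\}$, and for $\Delta\in\mathcal F$ $$\rho(\boldsymbol p,\Delta)=\min_{\boldsymbol q:\,H(\boldsymbol q)=\Delta}r(\boldsymbol p,\boldsymbol q).$$ This is concave in $\boldsymbol p$. With $\overline{\boldsymbol q}_n$ the empirical distribution of $J_1,\dots,J_n$, the per-round regret is $$R_n=\max_{\boldsymbol p}\rho(\boldsymbol p,H(\overline{\boldsymbol q}_n))-\frac1n\sum_{t=1}^nr(I_t,J_t).$$ **Sub-gradients, $K$ and $L$.** A vector $\boldsymbol b$ is a sub-gradient at $\boldsymbol x$ of a concave function $f$ defined on a convex set if $f(\boldsymbol y)-f(\boldsymbol x)\le\boldsymbol b\cdot(\boldsymbol y-\boldsymbol x)$ for all $\boldsymbol y$ in the domain; $\rho(\cdot,\Delta)$ has the probability simplex as its domain. $K=\sup_{\boldsymbol p}\sup_{\Delta\in\mathcal F}\sup_{\boldsymbol b\in\partial\rho(\boldsymbol p,\Delta)}\|\boldsymbol b\|_\infty$, where $\boldsymbol p$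 ranges over the simplex and $\partial\rho(\boldsymbol p,\Delta)$ is the set of sub-gradients at $\boldsymbol p$ of $\rho(\cdot,\Delta)$ extended to $\mathbb R^N$ by the same formula $\min_{\boldsymbol q:H(\boldsymbol q)=\Delta}\sum_{i,j}p_iq_jr(i,j)$. $L$ is a uniform Lipschitz constant of $\rho$ in its second argument: $|\rho(\boldsymbol p,\Delta)-\rho(\boldsymbol p,\Delta')|\le L\|\Delta-\Delta'\|_2$ for all $\boldsymbol p$ and all $\Delta,\Delta'\in\mathcal F$. **Forecaster.** Parameters: integer $m\ge1$, real $\eta>0$. Let $\Pi$ be the Euclidean projection onto $\mathcal F$, and for $b=0,1,\dots$ let $$\widehat\Delta^b=\Pi\Big(\frac1m\sum_{t=bm+1}^{(b+1)m}\delta_{s_t}\Big),$$ with $\delta_s$ the point mass at $s$. Initialize $\boldsymbol w^0=(1,\dots,1)\in\mathbb R^N$. In each round $t$ with $bm+1\le t\le(b+1)m$, play $I_t$ drawn from $\boldsymbol p_t=\boldsymbol p^b$, where $p^b_k=w^b_k/\sum_{j=1}^Nw^b_j$. At the end of round $t=(b+1)m$, update $w^{b+1}_k=w^b_k\,e^{\eta(\widetilde r(\boldsymbol p^b,\widehat\Delta^b))_k}$ for $k=1,\dots,N$, where $\widetilde r(\boldsymbol p,\Delta)$ denotes a sub-gradient of $\rho(\cdot,\Delta)$ at $\boldsymbol p$. **Conventions.** $a\sim b$ means that $a$ is chosen as a fixed positive numerical constant times $b$. The implied constant in $O(\cdot)$ may depend on game constants such as $K$ and $L$ but not on $n$ or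 $\delta$. For $\delta\ge1$ the probability statement in the first claim is vacuous. *)

theory Defs
  imports "HOL-Probability.Probability"
begin

text \<open>Actions are \<open>1, \<dots>, N\<close>, outcomes are \<open>1, \<dots>, M\<close>, and the signals are the elements of a
  finite type \<open>'s\<close>. Vectors indexed by signals live in \<open>real ^ 's\<close>; vectors indexed by actions or
  outcomes are functions on \<open>nat\<close> of which only the coordinates in \<open>{1..N}\<close> or \<open>{1..M}\<close> matter.\<close>

record 's game =
  num_actions :: nat
  num_outcomes :: nat
  reward :: "nat \<Rightarrow> nat \<Rightarrow> real"
  feedback :: "nat \<Rightarrow> 's pmf"

definition valid_game :: "'s game \<Rightarrow> bool" where
  "valid_game G \<longleftrightarrow> num_actions G \<ge> 1 \<and> num_outcomes G \<ge> 1 \<and>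
     (\<forall>i\<in>{1..num_actions G}. \<forall>j\<in>{1..num_outcomes G}. 0 \<le> reward G i j \<and> reward G i j \<le> 1)"

definition prob_simplex :: "nat \<Rightarrow> (nat \<Rightarrow> real) set" where
  "prob_simplex d = {p. (\<forall>i. 0 \<le> p i) \<and> (\<forall>i. i \<notin> {1..d} \<longrightarrow> p i = 0) \<and> (\<Sum>i=1..d. p i) = 1}"

definition mixed_reward :: "'s game \<Rightarrow> (nat \<Rightarrow> real) \<Rightarrow> (nat \<Rightarrow> real) \<Rightarrow> real" where
  "mixed_reward G p q = (\<Sum>i=1..num_actions G. \<Sum>j=1..num_outcomes G. p i * q j * reward G i j)"

definition mixed_feedback :: "('s::finite) game \<Rightarrow> (nat \<Rightarrow> real) \<Rightarrow> real ^ 's" where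
  "mixed_feedback G q = (\<Sum>j=1..num_outcomes G. q j *\<^sub>R (\<chi> s. pmf (feedback G j) s))"

definition feasible :: "('s::finite) game \<Rightarrow> (real ^ 's) set" where
  "feasible G = mixed_feedback G ` prob_simplex (num_outcomes G)"

text \<open>For feasible \<open>\<Delta>\<close> the infimum is a minimum, since a linear function is minimised over a nonempty
  compact set. The formula also makes sense for \<open>p\<close> outside the simplex.\<close>

definition rho :: "('s::finite) game \<Rightarrow> (nat \<Rightarrow> real) \<Rightarrow> real ^ 's \<Rightarrow> real" where
  "rho G p \<Delta> = (INF q\<in>{q \<in> prob_simplex (num_outcomes G). mixed_feedback G q = \<Delta>}. mixed_reward G p q)"

text \<open>Sub-gradients at \<open>x\<close> of a concave function \<open>f\<close> of \<open>d\<close> real variables with domain \<open>D\<close>.\<close>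

definition subgradients ::
    "nat \<Rightarrow> (nat \<Rightarrow> real) set \<Rightarrow> ((nat \<Rightarrow> real) \<Rightarrow> real) \<Rightarrow> (nat \<Rightarrow> real) \<Rightarrow> (nat \<Rightarrow> real) set" where
  "subgradients d D f x = {b. \<forall>y\<in>D. f y - f x \<le> (\<Sum>i=1..d. b i * (y i - x i))}"

definition sup_norm :: "nat \<Rightarrow> (nat \<Rightarrow> real) \<Rightarrow> real" where
  "sup_norm d b = Max ((\<lambda>i. \<bar>b i\<bar>) ` {1..d})"

text \<open>For the constant \<open>K\<close> the function \<open>rho G _ \<Delta>\<close> is taken on the whole space (\<open>UNIV\<close>),
  whereas the forecaster below may use any sub-gradients relative to the simplex.\<close>

definition subgradient_norms :: "('s::finite) game \<Rightarrow> real set" where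
  "subgradient_norms G =
     {sup_norm (num_actions G) b | b p \<Delta>. p \<in> prob_simplex (num_actions G) \<and> \<Delta> \<in> feasible G \<and>
        b \<in> subgradients (num_actions G) UNIV (\<lambda>x. rho G x \<Delta>) p}"

definition K_const :: "('s::finite) game \<Rightarrow> real" where
  "K_const G = Sup (subgradient_norms G)"

definition lipschitz_const :: "('s::finite) game \<Rightarrow> real \<Rightarrow> bool" where
  "lipschitz_const G L \<longleftrightarrow> (\<forall>p\<in>prob_simplex (num_actions G). L-lipschitz_on (feasible G) (rho G p))"

definition subgradient_selection ::
    "('s::finite) game \<Rightarrow> ((nat \<Rightarrow> real) \<Rightarrow> real ^ 's \<Rightarrow> nat \<Rightarrow> real) \<Rightarrow> bool" where
  "subgradient_selection G rt \<longleftrightarrow>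
     (\<forall>p\<in>prob_simplex (num_actions G). \<forall>\<Delta>\<in>feasible G.
        rt p \<Delta> \<in> subgradients (num_actions G) (prob_simplex (num_actions G)) (\<lambda>x. rho G x \<Delta>) p)"

text \<open>The history of the first \<open>n\<close> rounds is the list of the triples (outcome, action, signal), in
  chronological order; rounds are numbered from 1 and list positions from 0.\<close>

type_synonym 's history = "(nat \<times> nat \<times> 's) list"

definition outcome_at :: "'s history \<Rightarrow> nat \<Rightarrow> nat" where
  "outcome_at h t = fst (h ! (t - 1))"

definition action_at :: "'s history \<Rightarrow> nat \<Rightarrow> nat" where
  "action_at h t = fst (snd (h ! (t - 1)))"

definition signal_at :: "'s history \<Rightarrow> nat \<Rightarrow> 's" where
  "signal_at h t = snd (snd (h ! (t - 1)))"

definition empirical :: "'s history \<Rightarrow> nat \<Rightarrow> real" where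
  "empirical h j = real (card {t \<in> {1..length h}. outcome_at h t = j}) / real (length h)"

text \<open>The supremum is a maximum (a concave, continuous function on the compact simplex).\<close>

definition regret :: "('s::finite) game \<Rightarrow> 's history \<Rightarrow> real" where
  "regret G h =
     (SUP p\<in>prob_simplex (num_actions G). rho G p (mixed_feedback G (empirical h)))
     - (1 / real (length h)) * (\<Sum>t=1..length h. reward G (action_at h t) (outcome_at h t))"

text \<open>In the following definitions \<open>s t\<close> is the signal revealed in round \<open>t\<close>, and \<open>axis (s t) 1\<close> is
  the point mass at that signal.\<close>

definition Delta_hat :: "('s::finite) game \<Rightarrow> nat \<Rightarrow> (nat \<Rightarrow> 's) \<Rightarrow> nat \<Rightarrow> real ^ 's" where
  "Delta_hat G m s b =
     closest_point (feasible G) ((1 / real m) *\<^sub>R (\<Sum>t=b*m+1..(b+1)*m. axis (s t) 1))"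

definition normalized :: "nat \<Rightarrow> (nat \<Rightarrow> real) \<Rightarrow> nat \<Rightarrow> real" where
  "normalized d w k = (if k \<in> {1..d} then w k / (\<Sum>j=1..d. w j) else 0)"

primrec weights ::
    "('s::finite) game \<Rightarrow> ((nat \<Rightarrow> real) \<Rightarrow> real ^ 's \<Rightarrow> nat \<Rightarrow> real) \<Rightarrow> nat \<Rightarrow> real \<Rightarrow> (nat \<Rightarrow> 's)
       \<Rightarrow> nat \<Rightarrow> nat \<Rightarrow> real" where
  "weights G rt m \<eta> s 0 = (\<lambda>k. 1)"
| "weights G rt m \<eta> s (Suc b) = (\<lambda>k. weights G rt m \<eta> s b k *
     exp (\<eta> * rt (normalized (num_actions G) (weights G rt m \<eta> s b)) (Delta_hat G m s b) k))"

text \<open>After a history of length \<open>t - 1\<close>, the next round \<open>t\<close> lies in block \<open>b = (t - 1) div m\<close>; the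
  weights of this block only involve the signals of the rounds \<open>1, \<dots>, b * m\<close>, all of which precede
  round \<open>t\<close>.\<close>

definition forecaster ::
    "('s::finite) game \<Rightarrow> ((nat \<Rightarrow> real) \<Rightarrow> real ^ 's \<Rightarrow> nat \<Rightarrow> real) \<Rightarrow> nat \<Rightarrow> real
       \<Rightarrow> 's history \<Rightarrow> nat pmf" where
  "forecaster G rt m \<eta> h = embed_pmf
     (normalized (num_actions G) (weights G rt m \<eta> (signal_at h) (length h div m)))"

text \<open>A randomized strategy of the environment that reacts to the past assigns to every history the
  conditional law of the next outcome. Environments with private randomization are covered:
  conditioning on the history gives such a kernel that induces the same law of the game.\<close>

definition environment :: "'s game \<Rightarrow> ('s history \<Rightarrow> nat pmf) \<Rightarrow> bool" where
  "environment G env \<longleftrightarrow> (\<forall>h. set_pmf (env h) \<subseteq> {1..num_outcomes G})"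

text \<open>The law of the history of the first \<open>n\<close> rounds.\<close>

primrec play ::
    "'s game \<Rightarrow> ('s history \<Rightarrow> nat pmf) \<Rightarrow> ('s history \<Rightarrow> nat pmf) \<Rightarrow> nat \<Rightarrow> 's history pmf" where
  "play G env fc 0 = return_pmf []"
| "play G env fc (Suc n) =
     bind_pmf (play G env fc n) (\<lambda>h.
     bind_pmf (env h) (\<lambda>j.
     bind_pmf (fc h) (\<lambda>i.
     bind_pmf (feedback G j) (\<lambda>s.
     return_pmf (h @ [(j, i, s)])))))"

end

theory Submission
  imports Defs
begin

text \<open>The horizon splits into \<open>n div m\<close> full blocks and fewer than \<open>m\<close> further rounds. For a fixed
  mixed action \<open>p\<close>, \<open>rho G p\<close> is convex in the feedback vector: mixing minimisers of the single blocks
  gives a competitor for the feedback of the whole play. Hence \<open>n * rho G p (H q)\<close>, with \<open>q\<close> the empirical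
  law, is at most \<open>m\<close> times the sum over the blocks of \<open>rho G p \<Delta>\<^sub>b\<close>, where \<open>\<Delta>\<^sub>b\<close> is the mean feedback
  law of block \<open>b\<close>, plus at most \<open>m\<close> for the incomplete block (\<open>rho_block_convexity\<close>). Conversely the
  expected reward collected in block \<open>b\<close> is at least \<open>m * rho G p\<^sub>b \<Delta>\<^sub>b\<close>, because the empirical law of
  the outcomes of the block is one of the laws over which \<open>rho\<close> minimises. So the regret is controlled by the
  differences \<open>rho G p \<Delta>\<^sub>b - rho G p\<^sub>b \<Delta>\<^sub>b\<close>. Replacing \<open>\<Delta>\<^sub>b\<close> by its estimate costs \<open>2 * L\<close> times the
  estimation error, and for the estimates these differences are linearised by the sub-gradients and
  summed by the exponential weights analysis (\<open>estimated_rho_regret\<close>); all of this is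
  \<open>regret_on_good_event\<close>.

  The sub-gradients of the forecaster are relative to the simplex and may be arbitrarily large. But
  its mixed actions have full support, and there, since \<open>rho\<close> is positively homogeneous and superadditive
  in \<open>p\<close>, each of them is a sub-gradient on the whole space plus a multiple of the all-ones vector
  (\<open>simplex_subgradient_bounded_up_to_shift\<close>). Such a shift changes neither the weights after
  normalisation nor inner products with differences of mixed actions.

  Two random errors remain. The played actions lose little against their conditional means by the
  Azuma inequality (\<open>reward_shortfall_tail\<close>). The estimation error is a norm of a sum of vector-valued
  martingale differences. The difference of two probability vectors can have norm \<open>sqrt 2\<close>, so a general
  Hilbert space martingale inequality would lose a factor \<open>sqrt 2\<close> in the constant. Instead the square
  exponential \<open>exp (norm x ^ 2 / c)\<close> is propagated with a parameter \<open>c\<close> that grows by one in every round,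
  from \<open>m\<close> to \<open>2 * m\<close> (\<open>square_exponential_step\<close>): Hoeffding's lemma applies because adding a point mass
  changes the exponent by a linear function of one coordinate. The accumulated factor is the
  exponential of \<open>1/(m+1) + \<dots> + 1/(2*m) \<le> ln 2\<close>, which is the factor 2 in \<open>ln (2 / \<delta>)\<close>
  (\<open>deviation_tail\<close>).

  The existence of \<open>L\<close> is a Hoffman bound for the fibres of the feedback map on the simplex
  (\<open>preimage_lipschitz\<close>), obtained from nearest points and compactness.

  The rate follows with the failure probability \<open>\<delta> / (n / m + 1)\<close> for each event; a game with a single
  action has non-positive regret, which covers the case \<open>ln N = 0\<close>, where the tuned \<open>\<eta>\<close> vanishes.\<close>

section \<open>Compactness, and linearity of rewards and feedback\<close>

lemma continuous_coordinate: "continuous_on S (\<lambda>x :: nat \<Rightarrow> real. x i)"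
  using continuous_on_product_coordinates by (rule continuous_on_subset) simp

lemma compact_prob_simplex: "compact (prob_simplex d)"
proof -
  have eq: "prob_simplex d = (PiE UNIV (\<lambda>i. if i \<in> {1..d} then {0..1} else {0})) \<inter> {p. (\<Sum>i=1..d. p i) = 1}"
    (is "_ = ?K \<inter> ?C")
  proof (intro equalityI subsetI)
    fix p assume p: "p \<in> prob_simplex d"
    have "p i \<le> 1" if "i \<in> {1..d}" for i
      using member_le_sum[of i "{1..d}" p] p that by (auto simp: prob_simplex_def)
    with p show "p \<in> ?K \<inter> ?C" by (auto simp: prob_simplex_def PiE_def)
  next
    fix p assume p: "p \<in> ?K \<inter> ?C"
    have a: "p i \<in> (if i \<in> {1..d} then {0..1} else {0})" for i
      using p by (simp only: Int_iff PiE_iff) simp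
    have "0 \<le> p i" "i \<notin> {1..d} \<Longrightarrow> p i = 0" for i
      using a[of i] by (auto split: if_splits)
    with p show "p \<in> prob_simplex d" by (auto simp: prob_simplex_def)
  qed
  have "compact ?K"
    unfolding compactin_euclidean_iff[symmetric] euclidean_product_topology[symmetric]
    by (subst compactin_PiE) auto
  moreover have "closed ?C"
    by (intro closed_Collect_eq continuous_intros continuous_coordinate)
  ultimately show ?thesis unfolding eq by (rule compact_Int_closed)
qed

lemma prob_simplex_nonempty: "d \<ge> 1 \<Longrightarrow> (\<lambda>i. if i = 1 then 1 else 0) \<in> prob_simplex d"
  by (auto simp: prob_simplex_def sum.delta)

lemma convex_combination_in_prob_simplex:
  assumes "finite I" "\<And>i. i \<in> I \<Longrightarrow> a i \<ge> 0" "sum a I = 1" "\<And>i. i \<in> I \<Longrightarrow> x i \<in> prob_simplex d"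
  shows "(\<lambda>j. \<Sum>i\<in>I. a i * x i j) \<in> prob_simplex d"
proof -
  have "(\<Sum>j=1..d. \<Sum>i\<in>I. a i * x i j) = (\<Sum>i\<in>I. a i * (\<Sum>j=1..d. x i j))"
    by (subst sum.swap) (simp add: sum_distrib_left)
  also have "\<dots> = 1" using assms by (simp add: prob_simplex_def)
  finally show ?thesis using assms
    by (auto simp: prob_simplex_def intro!: sum_nonneg)
qed

lemma continuous_mixed_feedback: "continuous_on S (mixed_feedback G)"
  unfolding mixed_feedback_def by (intro continuous_intros continuous_coordinate)

lemma continuous_mixed_reward: "continuous_on S (mixed_reward G p)"
  unfolding mixed_reward_def by (intro continuous_intros continuous_coordinate)

lemma mixed_feedback_sum:
  "mixed_feedback G (\<lambda>j. \<Sum>i\<in>I. a i * x i j) = (\<Sum>i\<in>I. a i *\<^sub>R mixed_feedback G (x i))"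
  unfolding mixed_feedback_def
  by (simp add: scaleR_sum_left scaleR_sum_right, subst sum.swap, simp)

lemma mixed_reward_sum:
  "mixed_reward G p (\<lambda>j. \<Sum>i\<in>I. a i * x i j) = (\<Sum>i\<in>I. a i * mixed_reward G p (x i))"
proof -
  have "mixed_reward G p (\<lambda>j. \<Sum>i\<in>I. a i * x i j) =
      (\<Sum>k=1..num_actions G. \<Sum>j=1..num_outcomes G. \<Sum>i\<in>I. a i * (p k * x i j * reward G k j))"
    unfolding mixed_reward_def
    by (intro sum.cong refl) (simp add: sum_distrib_left sum_distrib_right mult_ac)
  also have "\<dots> = (\<Sum>k=1..num_actions G. \<Sum>i\<in>I. \<Sum>j=1..num_outcomes G. a i * (p k * x i j * reward G k j))"
    by (intro sum.cong refl sum.swap)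
  also have "\<dots> = (\<Sum>i\<in>I. \<Sum>k=1..num_actions G. \<Sum>j=1..num_outcomes G. a i * (p k * x i j * reward G k j))"
    by (rule sum.swap)
  finally show ?thesis unfolding mixed_reward_def by (simp add: sum_distrib_left)
qed

lemma mixed_feedback_diff:
  "mixed_feedback G (\<lambda>j. x j - c * y j) = mixed_feedback G x - c *\<^sub>R mixed_feedback G y"
  unfolding mixed_feedback_def by (simp add: scaleR_diff_left sum_subtractf scaleR_sum_right)

section \<open>The worst-case reward of a mixed action\<close>

definition fibre :: "('s::finite) game \<Rightarrow> real ^ 's \<Rightarrow> (nat \<Rightarrow> real) set" where
  "fibre G \<Delta> = {q \<in> prob_simplex (num_outcomes G). mixed_feedback G q = \<Delta>}"

lemma compact_fibre: "compact (fibre G \<Delta>)"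
proof -
  have "fibre G \<Delta> = prob_simplex (num_outcomes G) \<inter> {q. mixed_feedback G q = \<Delta>}"
    by (auto simp: fibre_def)
  moreover have "closed {q. mixed_feedback G q = \<Delta>}"
    by (intro closed_Collect_eq continuous_mixed_feedback continuous_intros)
  ultimately show ?thesis by (simp add: compact_Int_closed compact_prob_simplex)
qed

lemma fibre_nonempty: "\<Delta> \<in> feasible G \<longleftrightarrow> fibre G \<Delta> \<noteq> {}"
  by (auto simp: fibre_def feasible_def)

lemma rho_alt: "rho G p \<Delta> = (INF q\<in>fibre G \<Delta>. mixed_reward G p q)"
  by (simp add: rho_def fibre_def)

lemma rho_le:
  assumes "q \<in> prob_simplex (num_outcomes G)" "mixed_feedback G q = \<Delta>"
  shows "rho G p \<Delta> \<le> mixed_reward G p q"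
  unfolding rho_alt
proof (rule cINF_lower)
  show "bdd_below (mixed_reward G p ` fibre G \<Delta>)"
    by (intro bounded_imp_bdd_below compact_imp_bounded compact_continuous_image
        compact_fibre continuous_mixed_reward)
qed (use assms in \<open>auto simp: fibre_def\<close>)

lemma rho_attained:
  assumes "\<Delta> \<in> feasible G"
  obtains q where "q \<in> prob_simplex (num_outcomes G)" "mixed_feedback G q = \<Delta>"
    "rho G p \<Delta> = mixed_reward G p q"
proof -
  obtain q where q: "q \<in> fibre G \<Delta>" "\<forall>q'\<in>fibre G \<Delta>. mixed_reward G p q \<le> mixed_reward G p q'"
    using continuous_attains_inf[OF compact_fibre _ continuous_mixed_reward] assms
    by (metis fibre_nonempty)
  have "rho G p \<Delta> = mixed_reward G p q"
    unfolding rho_alt using q by (intro cInf_eq_minimum) auto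
  with q that show ?thesis by (auto simp: fibre_def)
qed

lemma mixed_reward_add_left:
  "mixed_reward G (\<lambda>i. x i + y i) q = mixed_reward G x q + mixed_reward G y q"
  unfolding mixed_reward_def by (simp add: distrib_right sum.distrib)

lemma mixed_reward_scale_left: "mixed_reward G (\<lambda>i. a * x i) q = a * mixed_reward G x q"
  unfolding mixed_reward_def by (simp add: sum_distrib_left mult_ac)

lemma mixed_reward_cong_left:
  "(\<And>i. i \<in> {1..num_actions G} \<Longrightarrow> x i = y i) \<Longrightarrow> mixed_reward G x q = mixed_reward G y q"
  unfolding mixed_reward_def by (intro sum.cong) auto

text \<open>Together with homogeneity this encodes the concavity of \<open>rho\<close> in \<open>p\<close>; it holds for all \<open>p\<close>,
  also outside the simplex, because a minimiser for the sum is a candidate for both summands.\<close>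
lemma rho_superadditive:
  assumes "\<Delta> \<in> feasible G"
  shows "rho G x \<Delta> + rho G y \<Delta> \<le> rho G (\<lambda>i. x i + y i) \<Delta>"
proof -
  obtain q where q: "q \<in> prob_simplex (num_outcomes G)" "mixed_feedback G q = \<Delta>"
    "rho G (\<lambda>i. x i + y i) \<Delta> = mixed_reward G (\<lambda>i. x i + y i) q"
    using rho_attained[OF assms] by blast
  then show ?thesis
    using rho_le[OF q(1,2), of x] rho_le[OF q(1,2), of y] by (simp add: mixed_reward_add_left)
qed

lemma rho_scale:
  assumes "\<Delta> \<in> feasible G" "a \<ge> 0"
  shows "rho G (\<lambda>i. a * x i) \<Delta> = a * rho G x \<Delta>"
proof (rule antisym)
  obtain q where q: "q \<in> prob_simplex (num_outcomes G)" "mixed_feedback G q = \<Delta>"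
    "rho G x \<Delta> = mixed_reward G x q"
    using rho_attained[OF assms(1)] by blast
  show "rho G (\<lambda>i. a * x i) \<Delta> \<le> a * rho G x \<Delta>"
    using rho_le[OF q(1,2), of "\<lambda>i. a * x i"] q(3) by (simp add: mixed_reward_scale_left)
  obtain q where q: "q \<in> prob_simplex (num_outcomes G)" "mixed_feedback G q = \<Delta>"
    "rho G (\<lambda>i. a * x i) \<Delta> = mixed_reward G (\<lambda>i. a * x i) q"
    using rho_attained[OF assms(1)] by blast
  show "a * rho G x \<Delta> \<le> rho G (\<lambda>i. a * x i) \<Delta>"
    using rho_le[OF q(1,2), of x] q(3) assms(2) by (simp add: mixed_reward_scale_left mult_left_mono)
qed

lemma rho_cong:
  "(\<And>i. i \<in> {1..num_actions G} \<Longrightarrow> x i = y i) \<Longrightarrow> rho G x \<Delta> = rho G y \<Delta>"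
  unfolding rho_def using mixed_reward_cong_left[of G x y] by simp

text \<open>The gradient of \<open>p \<mapsto> mixed_reward G p q\<close>.\<close>
definition outcome_reward :: "'s game \<Rightarrow> (nat \<Rightarrow> real) \<Rightarrow> nat \<Rightarrow> real" where
  "outcome_reward G q i = (\<Sum>j=1..num_outcomes G. q j * reward G i j)"

lemma mixed_reward_eq_dot: "mixed_reward G p q = (\<Sum>i=1..num_actions G. p i * outcome_reward G q i)"
  unfolding mixed_reward_def outcome_reward_def by (simp add: sum_distrib_left mult_ac)

lemma outcome_reward_bounds:
  assumes "valid_game G" "q \<in> prob_simplex (num_outcomes G)" "i \<in> {1..num_actions G}"
  shows "0 \<le> outcome_reward G q i" "outcome_reward G q i \<le> 1"
proof -
  have r: "0 \<le> reward G i j" "reward G i j \<le> 1" if "j \<in> {1..num_outcomes G}" for j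
    using assms that by (auto simp: valid_game_def)
  have q: "0 \<le> q j" for j using assms by (auto simp: prob_simplex_def)
  show "0 \<le> outcome_reward G q i" unfolding outcome_reward_def
    using r q by (intro sum_nonneg mult_nonneg_nonneg) auto
  have "outcome_reward G q i \<le> (\<Sum>j=1..num_outcomes G. q j * 1)" unfolding outcome_reward_def
    using r q by (intro sum_mono mult_left_mono) auto
  then show "outcome_reward G q i \<le> 1" using assms by (simp add: prob_simplex_def)
qed

lemma mixed_reward_bounds:
  assumes "valid_game G" "p \<in> prob_simplex (num_actions G)" "q \<in> prob_simplex (num_outcomes G)"
  shows "0 \<le> mixed_reward G p q" "mixed_reward G p q \<le> 1"
proof -
  note b = outcome_reward_bounds[OF assms(1,3)]
  have p: "0 \<le> p i" for i using assms by (auto simp: prob_simplex_def)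
  show "0 \<le> mixed_reward G p q" unfolding mixed_reward_eq_dot
    using b p by (intro sum_nonneg mult_nonneg_nonneg) auto
  have "mixed_reward G p q \<le> (\<Sum>i=1..num_actions G. p i * 1)" unfolding mixed_reward_eq_dot
    using b p by (intro sum_mono mult_left_mono) auto
  then show "mixed_reward G p q \<le> 1" using assms by (simp add: prob_simplex_def)
qed

section \<open>Sub-gradients\<close>

text \<open>By superadditivity a sub-gradient at any point majorises \<open>rho\<close> itself, so testing it
  with plus and minus a unit vector suffices: \<open>rho\<close> is at least \<open>0\<close> at the former and at least \<open>-1\<close> at the
  latter.\<close>
lemma subgradient_coordinate_bounds:
  assumes "valid_game G" "\<Delta> \<in> feasible G" "i \<in> {1..num_actions G}"
    and b: "b \<in> subgradients (num_actions G) UNIV (\<lambda>x. rho G x \<Delta>) p"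
  shows "0 \<le> b i" "b i \<le> 1"
proof -
  have ineq: "rho G v \<Delta> \<le> (\<Sum>k=1..num_actions G. b k * v k)" for v
  proof -
    have "rho G (\<lambda>k. p k + v k) \<Delta> - rho G p \<Delta> \<le> (\<Sum>k=1..num_actions G. b k * ((p k + v k) - p k))"
      using b unfolding subgradients_def by blast
    then show ?thesis using rho_superadditive[OF assms(2), of p v] by simp
  qed
  define e :: "real \<Rightarrow> nat \<Rightarrow> real" where "e a = (\<lambda>k. if k = i then a else 0)" for a
  have dot: "(\<Sum>k=1..num_actions G. f k * e a k) = f i * a" for f a
    using assms(3) by (simp add: e_def if_distrib[of "\<lambda>x. _ * x"] sum.delta cong: if_cong)
  have dot': "(\<Sum>k=1..num_actions G. e a k * f k) = f i * a" for f a
    using dot[of f a] by (simp add: mult.commute)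
  obtain q where q: "q \<in> prob_simplex (num_outcomes G)" "rho G (e 1) \<Delta> = mixed_reward G (e 1) q"
    using rho_attained[OF assms(2)] by blast
  show "0 \<le> b i"
    using ineq[of "e 1"] q(2) outcome_reward_bounds[OF assms(1) q(1) assms(3)]
    by (simp add: dot dot' mixed_reward_eq_dot del: One_nat_def)
  obtain q where q: "q \<in> prob_simplex (num_outcomes G)" "rho G (e (-1)) \<Delta> = mixed_reward G (e (-1)) q"
    using rho_attained[OF assms(2)] by blast
  show "b i \<le> 1"
    using ineq[of "e (-1)"] q(2) outcome_reward_bounds[OF assms(1) q(1) assms(3)]
    by (simp add: dot dot' mixed_reward_eq_dot del: One_nat_def)
qed

lemma sup_norm_le: "d \<ge> 1 \<Longrightarrow> (\<And>i. i \<in> {1..d} \<Longrightarrow> \<bar>b i\<bar> \<le> c) \<Longrightarrow> sup_norm d b \<le> c"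
  unfolding sup_norm_def by (subst Max_le_iff) auto

lemma le_sup_norm: "i \<in> {1..d} \<Longrightarrow> \<bar>b i\<bar> \<le> sup_norm d b"
  unfolding sup_norm_def by (intro Max_ge) auto

lemma subgradient_norms_le_1:
  assumes "valid_game G" "x \<in> subgradient_norms G" shows "x \<le> 1"
proof -
  obtain b p \<Delta> where *: "x = sup_norm (num_actions G) b" "\<Delta> \<in> feasible G"
    "b \<in> subgradients (num_actions G) UNIV (\<lambda>x. rho G x \<Delta>) p"
    using assms(2) unfolding subgradient_norms_def by blast
  show ?thesis unfolding *(1)
    using subgradient_coordinate_bounds[OF assms(1) *(2) _ *(3)] assms(1)
    by (intro sup_norm_le) (auto simp: valid_game_def)
qed

lemma bdd_above_subgradient_norms: "valid_game G \<Longrightarrow> bdd_above (subgradient_norms G)"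
  using subgradient_norms_le_1 by (meson bdd_aboveI)

lemma feasible_nonempty: "valid_game G \<Longrightarrow> feasible G \<noteq> {}"
  using prob_simplex_nonempty[of "num_outcomes G"] unfolding feasible_def valid_game_def by blast

lemma outcome_reward_is_subgradient:
  assumes "q \<in> prob_simplex (num_outcomes G)" "mixed_feedback G q = \<Delta>" "rho G p \<Delta> = mixed_reward G p q"
  shows "outcome_reward G q \<in> subgradients (num_actions G) UNIV (\<lambda>x. rho G x \<Delta>) p"
proof -
  have "rho G y \<Delta> - rho G p \<Delta> \<le> (\<Sum>i=1..num_actions G. outcome_reward G q i * (y i - p i))" for y
    using rho_le[OF assms(1,2), of y] assms(3)
    by (simp add: mixed_reward_eq_dot right_diff_distrib sum_subtractf mult.commute)
  then show ?thesis by (simp add: subgradients_def)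
qed

lemma K_const_le_1: assumes "valid_game G" shows "K_const G \<le> 1"
proof -
  obtain \<Delta> where \<Delta>: "\<Delta> \<in> feasible G" using feasible_nonempty[OF assms] by blast
  obtain p where p: "p \<in> prob_simplex (num_actions G)"
    using prob_simplex_nonempty assms unfolding valid_game_def by blast
  obtain q where "q \<in> prob_simplex (num_outcomes G)" "mixed_feedback G q = \<Delta>"
    "rho G p \<Delta> = mixed_reward G p q"
    using rho_attained[OF \<Delta>] by blast
  from outcome_reward_is_subgradient[OF this] have "subgradient_norms G \<noteq> {}"
    using p \<Delta> unfolding subgradient_norms_def by blast
  then show ?thesis unfolding K_const_def
    using subgradient_norms_le_1[OF assms] by (rule cSup_least)
qed

text \<open>The shift \<open>c\<close> makes the sub-gradient \<open>b - c\<close> agree with \<open>rho\<close> at \<open>p\<close>. Then it majorises \<open>rho\<close> on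
  the simplex, hence by homogeneity on the nonnegative orthant, and finally at an arbitrary \<open>y\<close>: as \<open>p\<close> has
  positive coordinates, \<open>a * p + y\<close> lies in the orthant for large \<open>a\<close>, and superadditivity splits it again.
  So \<open>b - c\<close> is one of the sub-gradients over which \<open>K_const\<close> is the supremum.\<close>
lemma simplex_subgradient_bounded_up_to_shift:
  assumes G: "valid_game G" and \<Delta>: "\<Delta> \<in> feasible G" and p: "p \<in> prob_simplex (num_actions G)"
    and pos: "\<And>i. i \<in> {1..num_actions G} \<Longrightarrow> p i > 0"
    and b: "b \<in> subgradients (num_actions G) (prob_simplex (num_actions G)) (\<lambda>x. rho G x \<Delta>) p"
  obtains c where "\<And>i. i \<in> {1..num_actions G} \<Longrightarrow> \<bar>b i - c\<bar> \<le> K_const G"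
proof -
  let ?N = "num_actions G"
  define c where "c = (\<Sum>i=1..?N. b i * p i) - rho G p \<Delta>"
  define b' where "b' i = b i - c" for i
  have sp: "(\<Sum>i=1..?N. p i) = 1" using p by (simp add: prob_simplex_def)
  have b'p: "(\<Sum>i=1..?N. b' i * p i) = rho G p \<Delta>"
    using sp by (simp add: b'_def left_diff_distrib sum_subtractf flip: sum_distrib_left) (simp add: c_def)
  have on_simplex: "rho G y \<Delta> \<le> (\<Sum>i=1..?N. b' i * y i)" if y: "y \<in> prob_simplex ?N" for y
  proof -
    have "rho G y \<Delta> - rho G p \<Delta> \<le> (\<Sum>i=1..?N. b i * (y i - p i))"
      using b y unfolding subgradients_def by blast
    moreover have "(\<Sum>i=1..?N. y i) = 1" using y by (simp add: prob_simplex_def)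
    ultimately show ?thesis
      by (simp add: b'_def left_diff_distrib right_diff_distrib sum_subtractf flip: sum_distrib_left)
        (simp add: c_def)
  qed
  have everywhere: "rho G y \<Delta> \<le> (\<Sum>i=1..?N. b' i * y i)" for y
  proof -
    \<comment> \<open>large enough for \<open>a * p i + y i \<ge> 1\<close> in every coordinate\<close>
    define a where "a = (\<Sum>i=1..?N. (\<bar>y i\<bar> + 1) / p i)"
    have ge: "a * p i \<ge> \<bar>y i\<bar> + 1" if i: "i \<in> {1..?N}" for i
    proof -
      have "(\<bar>y i\<bar> + 1) / p i \<le> a" unfolding a_def
        using pos i by (intro member_le_sum) (auto simp: less_imp_le)
      then show ?thesis using pos[OF i] by (simp add: divide_le_eq)
    qed
    have a0: "a \<ge> 0" unfolding a_def using pos by (intro sum_nonneg) (auto simp: less_imp_le)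
    define z where "z i = (if i \<in> {1..?N} then a * p i + y i else 0)" for i
    define s where "s = (\<Sum>i=1..?N. z i)"
    have z0: "z i \<ge> 0" for i using ge[of i] by (auto simp: z_def)
    have z1: "z i \<ge> 1" if "i \<in> {1..?N}" for i using ge[of i] that by (auto simp: z_def)
    have "1 \<in> {1..?N}" using G by (simp add: valid_game_def)
    then have "z 1 \<le> s" unfolding s_def using z0 by (intro member_le_sum) auto
    with z1[OF \<open>1 \<in> {1..?N}\<close>] have s: "s > 0" by linarith
    have "(\<lambda>i. z i / s) \<in> prob_simplex ?N"
      using z0 s by (auto simp: prob_simplex_def z_def sum_divide_distrib[symmetric])
        (simp add: s_def z_def)
    from on_simplex[OF this] have "s * rho G (\<lambda>i. z i / s) \<Delta> \<le> s * (\<Sum>i=1..?N. b' i * (z i / s))"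
      using s by (intro mult_left_mono) auto
    also have "s * (\<Sum>i=1..?N. b' i * (z i / s)) = (\<Sum>i=1..?N. b' i * z i)"
      using s by (simp add: sum_distrib_left)
    also have "s * rho G (\<lambda>i. z i / s) \<Delta> = rho G z \<Delta>"
      using rho_scale[OF \<Delta>, of s "\<lambda>i. z i / s"] s by simp
    also have "rho G z \<Delta> = rho G (\<lambda>i. a * p i + y i) \<Delta>"
      by (rule rho_cong) (simp add: z_def)
    also have "(\<Sum>i=1..?N. b' i * z i) = a * (\<Sum>i=1..?N. b' i * p i) + (\<Sum>i=1..?N. b' i * y i)"
      by (simp add: z_def distrib_left sum.distrib sum_distrib_left mult_ac)
    finally show ?thesis
      using rho_superadditive[OF \<Delta>, of "\<lambda>i. a * p i" y] rho_scale[OF \<Delta> a0, of p] b'p by simp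
  qed
  have "b' \<in> subgradients ?N UNIV (\<lambda>x. rho G x \<Delta>) p"
    unfolding subgradients_def using everywhere b'p
    by (simp add: right_diff_distrib sum_subtractf)
  then have "sup_norm ?N b' \<in> subgradient_norms G"
    using p \<Delta> unfolding subgradient_norms_def by blast
  then have "sup_norm ?N b' \<le> K_const G"
    unfolding K_const_def by (intro cSup_upper bdd_above_subgradient_norms G)
  then show thesis
    using that[of c] le_sup_norm[of _ ?N b'] by (fastforce simp: b'_def)
qed

section \<open>Lipschitz dependence on the feedback vector\<close>

definition l1_norm :: "nat \<Rightarrow> (nat \<Rightarrow> real) \<Rightarrow> real" where
  "l1_norm d v = (\<Sum>i=1..d. \<bar>v i\<bar>)"

lemma l1_norm_nonneg: "l1_norm d v \<ge> 0"
  unfolding l1_norm_def by (intro sum_nonneg) auto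

lemma l1_norm_scale: "l1_norm d (\<lambda>i. a * v i) = \<bar>a\<bar> * l1_norm d v"
  unfolding l1_norm_def by (simp add: abs_mult sum_distrib_left)

text \<open>The zero-sum condition holds for differences of probability vectors. The sign conditions on \<open>P\<close> and
  \<open>Q\<close> are weak inequalities, so that the cone is closed.\<close>
definition sign_cone :: "nat \<Rightarrow> nat set \<Rightarrow> nat set \<Rightarrow> (nat \<Rightarrow> real) set" where
  "sign_cone d P Q = {v. (\<Sum>i=1..d. v i) = 0 \<and> (\<forall>i. (i \<in> P \<longrightarrow> v i \<ge> 0) \<and> (i \<in> Q \<longrightarrow> v i \<le> 0) \<and>
     (i \<notin> P \<union> Q \<longrightarrow> v i = 0))}"

lemma sign_cone_scale: "v \<in> sign_cone d P Q \<Longrightarrow> a \<ge> 0 \<Longrightarrow> (\<lambda>i. a * v i) \<in> sign_cone d P Q"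
  unfolding sign_cone_def by (auto simp: mult_nonneg_nonpos sum_distrib_left[symmetric])

lemma compact_sign_cone_sphere:
  assumes "P \<subseteq> {1..d}" "Q \<subseteq> {1..d}"
  shows "compact (sign_cone d P Q \<inter> {v. l1_norm d v = 1})"
proof -
  define C where "C i = {a :: real. \<bar>a\<bar> \<le> 1 \<and> (i \<in> P \<longrightarrow> a \<ge> 0) \<and> (i \<in> Q \<longrightarrow> a \<le> 0) \<and> (i \<notin> P \<union> Q \<longrightarrow> a = 0)}" for i
  have C: "compact (C i)" for i
  proof -
    have "C i = {-1..1} \<inter> (if i \<in> P then {0..} else UNIV) \<inter> (if i \<in> Q then {..0} else UNIV)
        \<inter> (if i \<notin> P \<union> Q then {0} else UNIV)"
      unfolding C_def by (auto simp: abs_le_iff)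
    also have "compact \<dots>" by (intro compact_Int_closed) auto
    finally show ?thesis .
  qed
  have eq: "sign_cone d P Q \<inter> {v. l1_norm d v = 1} = PiE UNIV C \<inter> {v. (\<Sum>i=1..d. v i) = 0} \<inter> {v. l1_norm d v = 1}"
    (is "?L = ?R")
  proof (intro equalityI subsetI)
    fix v assume v: "v \<in> ?L"
    have "\<bar>v i\<bar> \<le> 1" for i
    proof (cases "i \<in> {1..d}")
      case True
      then have "\<bar>v i\<bar> \<le> l1_norm d v" unfolding l1_norm_def by (intro member_le_sum) auto
      with v show ?thesis by simp
    next
      case False
      then have "i \<notin> P \<union> Q" using assms by blast
      with v show ?thesis by (auto simp: sign_cone_def)
    qed
    with v show "v \<in> ?R" by (auto simp: sign_cone_def C_def)
  next
    fix v assume v: "v \<in> ?R"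
    then have "v i \<in> C i" for i by (auto simp only: Int_iff PiE_iff)
    with v show "v \<in> ?L" by (auto simp: sign_cone_def C_def)
  qed
  have "compact (PiE UNIV C)"
    unfolding compactin_euclidean_iff[symmetric] euclidean_product_topology[symmetric]
    by (subst compactin_PiE) (auto simp: C)
  moreover have "closed {v :: nat \<Rightarrow> real. (\<Sum>i=1..d. v i) = 0}"
    by (intro closed_Collect_eq continuous_intros continuous_coordinate)
  moreover have "closed {v. l1_norm d v = 1}" unfolding l1_norm_def
    by (intro closed_Collect_eq continuous_intros continuous_coordinate)
  ultimately show ?thesis unfolding eq by (intro compact_Int_closed)
qed

lemma mixed_feedback_scale: "mixed_feedback G (\<lambda>j. a * v j) = a *\<^sub>R mixed_feedback G v"
  unfolding mixed_feedback_def by (simp add: scaleR_sum_right)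

text \<open>By homogeneity it is enough to bound the feedback map from below on the compact unit
  sphere of the cone, where it has no zero.\<close>
lemma injective_on_sign_cone_bound:
  assumes PQ: "P \<subseteq> {1..num_outcomes G}" "Q \<subseteq> {1..num_outcomes G}"
    and inj: "\<And>v. v \<in> sign_cone (num_outcomes G) P Q \<Longrightarrow> mixed_feedback G v = 0 \<Longrightarrow> l1_norm (num_outcomes G) v = 0"
  obtains C where "C \<ge> 0"
    "\<And>v. v \<in> sign_cone (num_outcomes G) P Q \<Longrightarrow> l1_norm (num_outcomes G) v \<le> C * norm (mixed_feedback G v)"
proof -
  let ?d = "num_outcomes G"
  let ?S = "sign_cone ?d P Q \<inter> {v. l1_norm ?d v = 1}"
  have normalise: "(\<lambda>i. (1 / l1_norm ?d v) * v i) \<in> ?S" if "v \<in> sign_cone ?d P Q" "l1_norm ?d v \<noteq> 0" for v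
    using sign_cone_scale[OF that(1), of "1 / l1_norm ?d v"] that(2) l1_norm_nonneg[of ?d v]
    by (simp only: Int_iff mem_Collect_eq l1_norm_scale) simp
  show thesis
  proof (cases "?S = {}")
    case True
    then have "l1_norm ?d v = 0" if "v \<in> sign_cone ?d P Q" for v using normalise[OF that] by blast
    then show thesis using that[of 0] by simp
  next
    case False
    obtain u where u: "u \<in> ?S" "\<forall>v\<in>?S. norm (mixed_feedback G u) \<le> norm (mixed_feedback G v)"
      using continuous_attains_inf[OF compact_sign_cone_sphere[OF PQ] False
          continuous_on_norm[OF continuous_mixed_feedback]] by blast
    define \<mu> where "\<mu> = norm (mixed_feedback G u)"
    have \<mu>: "\<mu> > 0" using inj[of u] u(1) by (auto simp: \<mu>_def)
    have "l1_norm ?d v \<le> 1 / \<mu> * norm (mixed_feedback G v)" if v: "v \<in> sign_cone ?d P Q" for v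
    proof (cases "l1_norm ?d v = 0")
      case True then show ?thesis using \<mu> by simp
    next
      case False
      then have "\<mu> \<le> norm (mixed_feedback G (\<lambda>i. (1 / l1_norm ?d v) * v i))"
        using u(2) normalise[OF v] unfolding \<mu>_def by blast
      also have "\<dots> = norm (mixed_feedback G v) / l1_norm ?d v"
        using l1_norm_nonneg[of ?d v] by (simp only: mixed_feedback_scale norm_scaleR) simp
      finally show ?thesis using \<mu> False l1_norm_nonneg[of ?d v] by (simp add: field_simps)
    qed
    then show thesis using that[of "1 / \<mu>"] \<mu> by simp
  qed
qed

text \<open>If \<open>q'\<close> is the point of its fibre nearest to \<open>q\<close>, then no nonzero kernel vector \<open>v\<close> is
  compatible in sign with \<open>q' - q\<close>: moving from \<open>q'\<close> by a small multiple of \<open>- v\<close> would stay in the fibre,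
  between \<open>q\<close> and \<open>q'\<close> coordinatewise, and come closer to \<open>q\<close>.\<close>
lemma nearest_point_has_conformally_injective_difference:
  assumes q: "q \<in> prob_simplex d" and q': "q' \<in> prob_simplex d"
    and nearest: "\<And>y. y \<in> prob_simplex d \<Longrightarrow> mixed_feedback G y = mixed_feedback G q' \<Longrightarrow>
      l1_norm d (\<lambda>i. q' i - q i) \<le> l1_norm d (\<lambda>i. y i - q i)"
    and v: "v \<in> sign_cone d {i. q' i > q i} {i. q' i < q i}" "mixed_feedback G v = 0"
  shows "l1_norm d v = 0"
proof (rule ccontr)
  assume nz: "l1_norm d v \<noteq> 0"
  define \<delta> where "\<delta> i = q' i - q i" for i
  have v': "\<delta> i > 0 \<Longrightarrow> v i \<ge> 0" "\<delta> i < 0 \<Longrightarrow> v i \<le> 0" "\<delta> i = 0 \<Longrightarrow> v i = 0" for i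
    using v(1) by (auto simp: sign_cone_def \<delta>_def)
  have out: "\<delta> i = 0" if "i \<notin> {1..d}" for i using q q' that by (auto simp: \<delta>_def prob_simplex_def)
  \<comment> \<open>the step \<open>1 / s\<close> is small enough in every coordinate; where \<open>\<delta>\<close> vanishes, so does \<open>v\<close>\<close>
  define s where "s = 1 + (\<Sum>i=1..d. \<bar>v i\<bar> / \<bar>\<delta> i\<bar>)"
  have "(\<Sum>i=1..d. \<bar>v i\<bar> / \<bar>\<delta> i\<bar>) \<ge> 0" by (intro sum_nonneg) auto
  then have s: "s \<ge> 1" by (simp add: s_def)
  define \<epsilon> where "\<epsilon> = 1 / s"
  have \<epsilon>: "\<epsilon> > 0" using s by (simp add: \<epsilon>_def)
  have small: "\<epsilon> * \<bar>v i\<bar> \<le> \<bar>\<delta> i\<bar>" for i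
  proof (cases "\<delta> i = 0")
    case True then show ?thesis using v'(3) by simp
  next
    case False
    then have "i \<in> {1..d}" using out by blast
    then have "\<bar>v i\<bar> / \<bar>\<delta> i\<bar> \<le> (\<Sum>i=1..d. \<bar>v i\<bar> / \<bar>\<delta> i\<bar>)" by (intro member_le_sum) auto
    then have "\<bar>v i\<bar> / \<bar>\<delta> i\<bar> \<le> s" by (simp add: s_def)
    then show ?thesis using s False by (simp add: \<epsilon>_def field_simps)
  qed
  define y where "y i = q' i - \<epsilon> * v i" for i
  have y0: "y i \<ge> 0" for i
  proof (cases "\<delta> i > 0")
    case True
    have "q i \<ge> 0" using q by (simp add: prob_simplex_def)
    then show ?thesis using small[of i] v'(1)[OF True] True by (simp add: y_def \<delta>_def)
  next
    case False
    then have "\<epsilon> * v i \<le> 0" using v'(2,3)[of i] \<epsilon> by (cases "\<delta> i = 0") (auto intro: mult_nonneg_nonpos)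
    moreover have "q' i \<ge> 0" using q' by (simp add: prob_simplex_def)
    ultimately show ?thesis by (simp add: y_def)
  qed
  have sv: "(\<Sum>i=1..d. v i) = 0" using v(1) by (simp add: sign_cone_def)
  have "y \<in> prob_simplex d"
    using y0 q' out v'(3) sv
    by (auto simp: prob_simplex_def y_def sum_subtractf sum_distrib_left[symmetric])
  moreover have "mixed_feedback G y = mixed_feedback G q'"
    unfolding y_def using v(2) by (simp add: mixed_feedback_diff)
  ultimately have "l1_norm d \<delta> \<le> l1_norm d (\<lambda>i. y i - q i)"
    using nearest unfolding \<delta>_def by blast
  also have "l1_norm d (\<lambda>i. y i - q i) = (\<Sum>i=1..d. \<bar>\<delta> i\<bar> - \<epsilon> * \<bar>v i\<bar>)"
    unfolding l1_norm_def
  proof (intro sum.cong refl)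
    fix i
    have "y i - q i = \<delta> i - \<epsilon> * v i" by (simp add: y_def \<delta>_def)
    then show "\<bar>y i - q i\<bar> = \<bar>\<delta> i\<bar> - \<epsilon> * \<bar>v i\<bar>"
      using small[of i] v'[of i] by (cases "\<delta> i" "0 :: real" rule: linorder_cases) (auto simp: abs_if)
  qed
  also have "\<dots> = l1_norm d \<delta> - \<epsilon> * l1_norm d v" by (simp add: l1_norm_def sum_subtractf sum_distrib_left)
  finally show False using \<epsilon> nz l1_norm_nonneg[of d v] by (simp add: mult_le_0_iff)
qed

text \<open>A Hoffman bound. The difference between \<open>q\<close> and the nearest point of the fibre over \<open>\<Delta>\<close> lies in a sign
  cone on which the feedback map is injective; there are finitely many sign cones, so their constants
  have a common bound.\<close>
lemma preimage_lipschitz: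
  fixes G :: "('s::finite) game"
  obtains C where "C \<ge> 0"
    "\<And>q \<Delta>. q \<in> prob_simplex (num_outcomes G) \<Longrightarrow> \<Delta> \<in> feasible G \<Longrightarrow>
      \<exists>q'\<in>prob_simplex (num_outcomes G). mixed_feedback G q' = \<Delta> \<and>
        l1_norm (num_outcomes G) (\<lambda>i. q' i - q i) \<le> C * norm (\<Delta> - mixed_feedback G q)"
proof -
  let ?d = "num_outcomes G"
  define inj where "inj P Q \<longleftrightarrow> (\<forall>v\<in>sign_cone ?d P Q. mixed_feedback G v = 0 \<longrightarrow> l1_norm ?d v = 0)" for P Q
  define c where "c P Q = (SOME C. C \<ge> 0 \<and>
      (inj P Q \<longrightarrow> (\<forall>v\<in>sign_cone ?d P Q. l1_norm ?d v \<le> C * norm (mixed_feedback G v))))" for P Q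
  have c: "c P Q \<ge> 0 \<and> (inj P Q \<longrightarrow> (\<forall>v\<in>sign_cone ?d P Q. l1_norm ?d v \<le> c P Q * norm (mixed_feedback G v)))"
    if PQ: "P \<subseteq> {1..?d}" "Q \<subseteq> {1..?d}" for P Q
    unfolding c_def
  proof (rule someI_ex, cases "inj P Q")
    case True
    obtain C where "C \<ge> 0" "\<And>v. v \<in> sign_cone ?d P Q \<Longrightarrow> l1_norm ?d v \<le> C * norm (mixed_feedback G v)"
      using injective_on_sign_cone_bound[OF PQ] True unfolding inj_def by blast
    then show "\<exists>C\<ge>0. inj P Q \<longrightarrow> (\<forall>v\<in>sign_cone ?d P Q. l1_norm ?d v \<le> C * norm (mixed_feedback G v))"
      by blast
  qed (auto intro: exI[of _ 0])
  define C where "C = (\<Sum>(P, Q)\<in>Pow {1..?d} \<times> Pow {1..?d}. c P Q)"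
  have C: "c P Q \<le> C" if "P \<subseteq> {1..?d}" "Q \<subseteq> {1..?d}" for P Q
    unfolding C_def
    using member_le_sum[of "(P, Q)" "Pow {1..?d} \<times> Pow {1..?d}" "\<lambda>(P, Q). c P Q"] that c by auto
  have "C \<ge> 0" unfolding C_def using c by (intro sum_nonneg) auto
  moreover have "\<exists>q'\<in>prob_simplex ?d. mixed_feedback G q' = \<Delta> \<and>
        l1_norm ?d (\<lambda>i. q' i - q i) \<le> C * norm (\<Delta> - mixed_feedback G q)"
    if q: "q \<in> prob_simplex ?d" and \<Delta>: "\<Delta> \<in> feasible G" for q \<Delta>
  proof -
    have cont: "continuous_on (fibre G \<Delta>) (\<lambda>y. l1_norm ?d (\<lambda>i. y i - q i))"
      unfolding l1_norm_def by (intro continuous_intros continuous_coordinate)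
    obtain q' where q': "q' \<in> fibre G \<Delta>"
      and min: "\<forall>y\<in>fibre G \<Delta>. l1_norm ?d (\<lambda>i. q' i - q i) \<le> l1_norm ?d (\<lambda>i. y i - q i)"
      using continuous_attains_inf[OF compact_fibre _ cont] \<Delta> unfolding fibre_nonempty by blast
    define P Q where "P = {i. q' i > q i}" and "Q = {i. q' i < q i}"
    have sub: "P \<subseteq> {1..?d}" "Q \<subseteq> {1..?d}"
    proof -
      have "q' i = q i" if "i \<notin> {1..?d}" for i
        using q q' that by (simp add: fibre_def prob_simplex_def)
      then show "P \<subseteq> {1..?d}" "Q \<subseteq> {1..?d}" unfolding P_def Q_def by fastforce+
    qed
    have "inj P Q" unfolding inj_def
    proof (intro ballI impI)
      fix v assume "v \<in> sign_cone ?d P Q" "mixed_feedback G v = 0"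
      then show "l1_norm ?d v = 0" unfolding P_def Q_def
        using q' min q
        by (intro nearest_point_has_conformally_injective_difference[of q ?d q' G v])
          (auto simp: fibre_def)
    qed
    moreover have "(\<lambda>i. q' i - q i) \<in> sign_cone ?d P Q"
      using q q' by (auto simp: sign_cone_def P_def Q_def fibre_def prob_simplex_def sum_subtractf)
    ultimately have "l1_norm ?d (\<lambda>i. q' i - q i) \<le> c P Q * norm (mixed_feedback G (\<lambda>i. q' i - q i))"
      using c[OF sub] by blast
    also have "\<dots> \<le> C * norm (mixed_feedback G (\<lambda>i. q' i - q i))"
      using C[OF sub] by (intro mult_right_mono) auto
    also have "mixed_feedback G (\<lambda>i. q' i - q i) = \<Delta> - mixed_feedback G q"
      using mixed_feedback_diff[of G q' 1 q] q' by (simp add: fibre_def)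
    finally show ?thesis using q' by (auto simp: fibre_def)
  qed
  ultimately show thesis using that by blast
qed

lemma mixed_reward_diff_le_l1:
  assumes G: "valid_game G" and p: "p \<in> prob_simplex (num_actions G)"
  shows "mixed_reward G p q' - mixed_reward G p q \<le> l1_norm (num_outcomes G) (\<lambda>i. q' i - q i)"
proof -
  let ?N = "num_actions G" and ?M = "num_outcomes G"
  have "mixed_reward G p q' - mixed_reward G p q
      = (\<Sum>i=1..?N. \<Sum>j=1..?M. p i * ((q' j - q j) * reward G i j))"
    unfolding mixed_reward_def by (simp add: sum_subtractf algebra_simps)
  also have "\<dots> \<le> (\<Sum>i=1..?N. \<Sum>j=1..?M. p i * \<bar>q' j - q j\<bar>)"
  proof (intro sum_mono mult_left_mono)
    fix i j assume "i \<in> {1..?N}" "j \<in> {1..?M}"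
    then have r: "0 \<le> reward G i j" "reward G i j \<le> 1" using G by (auto simp: valid_game_def)
    have "(q' j - q j) * reward G i j \<le> \<bar>q' j - q j\<bar> * reward G i j"
      using r by (intro mult_right_mono) auto
    also have "\<dots> \<le> \<bar>q' j - q j\<bar> * 1" using r by (intro mult_left_mono) auto
    finally show "(q' j - q j) * reward G i j \<le> \<bar>q' j - q j\<bar>" by simp
  qed (use p in \<open>auto simp: prob_simplex_def\<close>)
  also have "\<dots> = l1_norm ?M (\<lambda>i. q' i - q i)"
    using p by (simp add: l1_norm_def prob_simplex_def flip: sum_distrib_left sum_distrib_right)
  finally show ?thesis .
qed

text \<open>Move a minimiser for \<open>\<Delta>\<close> to a nearby point of the fibre over \<open>\<Delta>'\<close>; the reward is 1-Lipschitz in the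
  outcome law for the \<open>l1\<close> norm.\<close>
lemma lipschitz_const_exists:
  assumes G: "valid_game G" shows "\<exists>L. lipschitz_const G L"
proof -
  obtain C where C: "C \<ge> 0"
    "\<And>q \<Delta>. q \<in> prob_simplex (num_outcomes G) \<Longrightarrow> \<Delta> \<in> feasible G \<Longrightarrow>
      \<exists>q'\<in>prob_simplex (num_outcomes G). mixed_feedback G q' = \<Delta> \<and>
        l1_norm (num_outcomes G) (\<lambda>i. q' i - q i) \<le> C * norm (\<Delta> - mixed_feedback G q)"
    using preimage_lipschitz[of G] by blast
  have one_sided: "rho G p \<Delta>' - rho G p \<Delta> \<le> C * dist \<Delta> \<Delta>'"
    if p: "p \<in> prob_simplex (num_actions G)" and D: "\<Delta> \<in> feasible G" "\<Delta>' \<in> feasible G" for p \<Delta> \<Delta>'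
  proof -
    obtain q where q: "q \<in> prob_simplex (num_outcomes G)" "mixed_feedback G q = \<Delta>"
      "rho G p \<Delta> = mixed_reward G p q" using rho_attained[OF D(1)] by blast
    obtain q' where q': "q' \<in> prob_simplex (num_outcomes G)" "mixed_feedback G q' = \<Delta>'"
      "l1_norm (num_outcomes G) (\<lambda>i. q' i - q i) \<le> C * norm (\<Delta>' - mixed_feedback G q)"
      using C(2)[OF q(1) D(2)] by blast
    show ?thesis
      using rho_le[OF q'(1,2), of p] q q'(3) mixed_reward_diff_le_l1[OF G p, of q' q]
      by (simp add: dist_norm norm_minus_commute)
  qed
  have "lipschitz_const G C" unfolding lipschitz_const_def
  proof (intro ballI lipschitz_onI C(1))
    fix p \<Delta> \<Delta>' assume *: "p \<in> prob_simplex (num_actions G)" "\<Delta> \<in> feasible G" "\<Delta>' \<in> feasible G"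
    show "dist (rho G p \<Delta>) (rho G p \<Delta>') \<le> C * dist \<Delta> \<Delta>'"
      using one_sided[OF *] one_sided[OF *(1,3,2)]
      by (simp add: dist_real_def abs_le_iff dist_commute)
  qed
  then show ?thesis by blast
qed

section \<open>Hoeffding's lemma and exponential weights\<close>

lemma hoeffding_lemma_pmf:
  fixes f :: "'a \<Rightarrow> real"
  assumes "l > 0" "\<And>x. x \<in> set_pmf p \<Longrightarrow> a \<le> f x \<and> f x \<le> b"
  shows "(\<integral>\<^sup>+x. ennreal (exp (l * f x)) \<partial>measure_pmf p)
    \<le> ennreal (exp (l * measure_pmf.expectation p f + l\<^sup>2 * (b - a)\<^sup>2 / 8))"
proof -
  interpret interval_bounded_random_variable "measure_pmf p" f a b
    by unfold_locales (use assms in \<open>auto simp: AE_measure_pmf_iff\<close>)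
  let ?\<mu> = "measure_pmf.expectation p f"
  have "(\<integral>\<^sup>+x. ennreal (exp (l * f x)) \<partial>measure_pmf p)
      = (\<integral>\<^sup>+x. ennreal (exp (l * ?\<mu>)) * ennreal (exp (l * (f x - ?\<mu>))) \<partial>measure_pmf p)"
    by (intro nn_integral_cong) (simp add: algebra_simps flip: ennreal_mult exp_add)
  also have "\<dots> = ennreal (exp (l * ?\<mu>)) * (\<integral>\<^sup>+x. ennreal (exp (l * (f x - ?\<mu>))) \<partial>measure_pmf p)"
    by (rule nn_integral_cmult) simp
  also have "\<dots> \<le> ennreal (exp (l * ?\<mu>)) * ennreal (exp (l\<^sup>2 * (b - a)\<^sup>2 / 8))"
    using Hoeffdings_lemma_nn_integral[OF assms(1)] by (intro mult_left_mono) auto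
  also have "\<dots> = ennreal (exp (l * ?\<mu> + l\<^sup>2 * (b - a)\<^sup>2 / 8))"
    by (simp add: exp_add ennreal_mult)
  finally show ?thesis .
qed

lemma pmf_embed_prob_simplex:
  assumes p: "p \<in> prob_simplex d"
  shows "pmf (embed_pmf p) = p" "set_pmf (embed_pmf p) \<subseteq> {1..d}"
proof -
  have p0: "p i \<ge> 0" for i using p by (auto simp: prob_simplex_def)
  have "(\<integral>\<^sup>+i. ennreal (p i) \<partial>count_space UNIV) = (\<Sum>i=1..d. ennreal (p i))"
    using p by (intro nn_integral_count_space') (auto simp: prob_simplex_def)
  also have "\<dots> = 1" using p by (simp add: prob_simplex_def sum_ennreal)
  finally have "pmf (embed_pmf p) i = p i" for i using p0 by (intro pmf_embed_pmf) auto
  then show eq: "pmf (embed_pmf p) = p" by blast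
  show "set_pmf (embed_pmf p) \<subseteq> {1..d}"
    using p by (auto simp: set_pmf_iff eq prob_simplex_def)
qed

lemma expectation_embed_prob_simplex:
  fixes f :: "nat \<Rightarrow> real"
  assumes p: "p \<in> prob_simplex d"
  shows "measure_pmf.expectation (embed_pmf p) f = (\<Sum>i=1..d. p i * f i)"
  using pmf_embed_prob_simplex[OF p]
  by (subst integral_measure_pmf_real[of "{1..d}"]) (auto simp: mult.commute)

lemma hoeffding_lemma_prob_simplex:
  assumes p: "p \<in> prob_simplex d" and l: "l > 0"
    and f: "\<And>i. i \<in> {1..d} \<Longrightarrow> a \<le> f i \<and> f i \<le> b"
  shows "(\<Sum>i=1..d. p i * exp (l * f i)) \<le> exp (l * (\<Sum>i=1..d. p i * f i) + l\<^sup>2 * (b - a)\<^sup>2 / 8)"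
proof -
  note e = pmf_embed_prob_simplex[OF p]
  have fin: "finite (set_pmf (embed_pmf p))" using e(2) by (rule finite_subset) simp
  have "ennreal (\<Sum>i=1..d. p i * exp (l * f i))
      = ennreal (measure_pmf.expectation (embed_pmf p) (\<lambda>i. exp (l * f i)))"
    by (simp add: expectation_embed_prob_simplex[OF p])
  also have "\<dots> = (\<integral>\<^sup>+i. ennreal (exp (l * f i)) \<partial>measure_pmf (embed_pmf p))"
    by (intro nn_integral_eq_integral[symmetric] integrable_measure_pmf_finite fin) simp
  also have "\<dots> \<le> ennreal (exp (l * measure_pmf.expectation (embed_pmf p) f + l\<^sup>2 * (b - a)\<^sup>2 / 8))"
    using f e(2) by (intro hoeffding_lemma_pmf l) blast
  finally show ?thesis by (simp add: expectation_embed_prob_simplex[OF p])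
qed

lemma normalized_in_prob_simplex:
  assumes "d \<ge> 1" "\<And>k. k \<in> {1..d} \<Longrightarrow> w k > 0"
  shows "normalized d w \<in> prob_simplex d" "\<And>k. k \<in> {1..d} \<Longrightarrow> normalized d w k > 0"
proof -
  have s: "(\<Sum>j=1..d. w j) > 0" using assms by (intro sum_pos) auto
  show "k \<in> {1..d} \<Longrightarrow> normalized d w k > 0" for k
    using s assms(2) by (simp add: normalized_def)
  have "(\<Sum>k=1..d. normalized d w k) = (\<Sum>k=1..d. w k / (\<Sum>j=1..d. w j))"
    by (intro sum.cong) (auto simp: normalized_def)
  also have "\<dots> = 1" using s by (simp flip: sum_divide_distrib)
  finally show "normalized d w \<in> prob_simplex d"
    using s assms(2) by (auto simp: prob_simplex_def normalized_def intro!: divide_nonneg_pos less_imp_le)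
qed

text \<open>The potential is the total weight. Hoeffding's lemma bounds its growth in each step, with the range
  \<open>2 * K\<close> of the gains around an unknown centre, and a single weight bounds it from below; averaging the
  resulting inequality for each single action with the weights \<open>y\<close> gives the mixed comparator.\<close>
lemma exponential_weights_regret:
  fixes w g :: "nat \<Rightarrow> nat \<Rightarrow> real"
  assumes d: "d \<ge> 1" and \<eta>: "\<eta> > 0"
    and w0: "\<And>k. w 0 k = 1" and wSuc: "\<And>b k. w (Suc b) k = w b k * exp (\<eta> * g b k)"
    and g: "\<And>b. b < B \<Longrightarrow> \<exists>c. \<forall>k\<in>{1..d}. \<bar>g b k - c\<bar> \<le> K"
    and y: "y \<in> prob_simplex d"
  shows "(\<Sum>b<B. \<Sum>k=1..d. g b k * (y k - normalized d (w b) k)) \<le> ln d / \<eta> + B * (K\<^sup>2 * \<eta> / 2)"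
proof -
  define W where "W b = (\<Sum>k=1..d. w b k)" for b
  define A where "A b = (\<Sum>k=1..d. normalized d (w b) k * g b k)" for b
  have w_exp: "w b k = exp (\<eta> * (\<Sum>b<b. g b k))" for b k
    by (induction b) (simp_all add: w0 wSuc exp_add distrib_left)
  have wpos: "w b k > 0" for b k by (simp add: w_exp)
  have Wpos: "W b > 0" for b unfolding W_def using d wpos by (intro sum_pos) auto
  have step: "W (Suc b) \<le> W b * exp (\<eta> * A b + \<eta>\<^sup>2 * K\<^sup>2 / 2)" if b: "b < B" for b
  proof -
    obtain c where c: "\<bar>g b k - c\<bar> \<le> K" if "k \<in> {1..d}" for k using g[OF b] by blast
    have "W (Suc b) = W b * (\<Sum>k=1..d. normalized d (w b) k * exp (\<eta> * g b k))"
      unfolding W_def sum_distrib_left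
    proof (intro sum.cong refl)
      fix k assume "k \<in> {1..d}"
      then show "w (Suc b) k = sum (w b) {1..d} * (normalized d (w b) k * exp (\<eta> * g b k))"
        using Wpos[of b] by (simp add: W_def wSuc normalized_def)
    qed
    also have "(\<Sum>k=1..d. normalized d (w b) k * exp (\<eta> * g b k))
        \<le> exp (\<eta> * A b + \<eta>\<^sup>2 * ((c + K) - (c - K))\<^sup>2 / 8)"
      unfolding A_def
    proof (rule hoeffding_lemma_prob_simplex[OF normalized_in_prob_simplex(1)[OF d wpos] \<eta>])
      fix k assume "k \<in> {1..d}"
      from c[OF this] show "c - K \<le> g b k \<and> g b k \<le> c + K" by (simp add: abs_le_iff)
    qed
    also have "\<eta>\<^sup>2 * ((c + K) - (c - K))\<^sup>2 / 8 = \<eta>\<^sup>2 * K\<^sup>2 / 2" by (simp add: power2_eq_square)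
    finally show ?thesis using Wpos[of b] by (simp add: mult_left_mono)
  qed
  have upper: "b \<le> B \<Longrightarrow> W b \<le> d * exp (\<eta> * (\<Sum>b<b. A b) + b * (\<eta>\<^sup>2 * K\<^sup>2 / 2))" for b
  proof (induction b)
    case 0
    then show ?case by (simp add: W_def w0)
  next
    case (Suc b)
    have "W (Suc b) \<le> W b * exp (\<eta> * A b + \<eta>\<^sup>2 * K\<^sup>2 / 2)" using Suc.prems by (intro step) simp
    also have "\<dots> \<le> d * exp (\<eta> * (\<Sum>b<b. A b) + b * (\<eta>\<^sup>2 * K\<^sup>2 / 2)) * exp (\<eta> * A b + \<eta>\<^sup>2 * K\<^sup>2 / 2)"
      using Suc by (intro mult_right_mono) auto
    also have "\<dots> = d * exp (\<eta> * (\<Sum>b<Suc b. A b) + Suc b * (\<eta>\<^sup>2 * K\<^sup>2 / 2))"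
      by (simp add: algebra_simps flip: exp_add)
    finally show ?case .
  qed
  have single: "(\<Sum>b<B. g b k) \<le> (\<Sum>b<B. A b) + (ln d / \<eta> + B * (K\<^sup>2 * \<eta> / 2))" if k: "k \<in> {1..d}" for k
  proof -
    have "exp (\<eta> * (\<Sum>b<B. g b k)) \<le> W B"
      unfolding W_def w_exp using k by (intro member_le_sum) auto
    also have "\<dots> \<le> exp (ln d + (\<eta> * (\<Sum>b<B. A b) + B * (\<eta>\<^sup>2 * K\<^sup>2 / 2)))"
      using upper[of B] d by (simp add: exp_add)
    finally have "\<eta> * (\<Sum>b<B. g b k) \<le> ln d + (\<eta> * (\<Sum>b<B. A b) + B * (\<eta>\<^sup>2 * K\<^sup>2 / 2))" by simp
    also have "\<dots> = \<eta> * ((\<Sum>b<B. A b) + (ln d / \<eta> + B * (K\<^sup>2 * \<eta> / 2)))"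
      using \<eta> by (simp add: field_simps power2_eq_square)
    finally show ?thesis using \<eta> by simp
  qed
  have "(\<Sum>b<B. \<Sum>k=1..d. g b k * (y k - normalized d (w b) k))
      = (\<Sum>b<B. \<Sum>k=1..d. y k * g b k) - (\<Sum>b<B. A b)"
    by (simp add: A_def right_diff_distrib sum_subtractf mult.commute)
  also have "(\<Sum>b<B. \<Sum>k=1..d. y k * g b k) = (\<Sum>k=1..d. y k * (\<Sum>b<B. g b k))"
    by (subst sum.swap) (simp add: sum_distrib_left)
  also have "\<dots> \<le> (\<Sum>k=1..d. y k * ((\<Sum>b<B. A b) + (ln d / \<eta> + B * (K\<^sup>2 * \<eta> / 2))))"
    using single y by (intro sum_mono mult_left_mono) (auto simp: prob_simplex_def)
  also have "\<dots> = (\<Sum>b<B. A b) + (ln d / \<eta> + B * (K\<^sup>2 * \<eta> / 2))"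
    using y by (simp add: prob_simplex_def flip: sum_distrib_right)
  finally show ?thesis by simp
qed

section \<open>A square-exponential estimate for random point masses\<close>

lemma coordinate_gap_le_norm:
  fixes y :: "real ^ 's::finite"
  shows "\<bar>y $ s - y $ s'\<bar> \<le> sqrt 2 * norm y"
proof (cases "s = s'")
  case False
  have "(\<Sum>u\<in>{s, s'}. (y $ u)\<^sup>2) \<le> (\<Sum>u\<in>UNIV. (y $ u)\<^sup>2)" by (intro sum_mono2) auto
  then have "(y $ s)\<^sup>2 + (y $ s')\<^sup>2 \<le> (norm y)\<^sup>2"
    using False by (simp add: norm_vec_def L2_set_def sum_nonneg)
  moreover have "(y $ s - y $ s')\<^sup>2 + (y $ s + y $ s')\<^sup>2 = 2 * ((y $ s)\<^sup>2 + (y $ s')\<^sup>2)"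
    by (simp add: power2_eq_square algebra_simps)
  ultimately have "(y $ s - y $ s')\<^sup>2 \<le> 2 * (norm y)\<^sup>2"
    by (smt (verit) zero_le_power2)
  then have "\<bar>y $ s - y $ s'\<bar> \<le> sqrt (2 * (norm y)\<^sup>2)" by (intro real_le_rsqrt) simp
  then show ?thesis by (simp add: real_sqrt_mult)
qed simp

definition pmf_vec :: "'s pmf \<Rightarrow> real ^ 's::finite" where
  "pmf_vec p = (\<chi> s. pmf p s)"

text \<open>Write \<open>y = x - v\<close> with \<open>v\<close> the mean of the point mass. The square of the norm of \<open>y + axis s 1\<close> is
  \<open>norm y ^ 2 + 1 + 2 * y $ s\<close>, and the coordinates of \<open>y\<close> have range at most \<open>sqrt 2 * norm y\<close>, so Hoeffding's
  lemma bounds the logarithm of the integral by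
  \<open>1 / c + (norm x ^ 2 - norm v ^ 2) / c + norm (x - v) ^ 2 / c ^ 2\<close>. By Young's inequality, with weights chosen
  to cancel the terms in \<open>v\<close>, this is at most \<open>1 / c + norm x ^ 2 / (c - 1)\<close>: passing one round back
  costs the summand \<open>1 / c\<close> and lowers \<open>c\<close> by one, independently of the number of signals.\<close>
lemma square_exponential_step:
  fixes x :: "real ^ 's::finite"
  assumes c: "c > 1"
  shows "(\<integral>\<^sup>+s. ennreal (exp ((norm (x + (axis s 1 - pmf_vec p)))\<^sup>2 / c)) \<partial>measure_pmf p)
    \<le> ennreal (exp (1 / c + (norm x)\<^sup>2 / (c - 1)))"
proof -
  define v where "v = pmf_vec p"
  define y where "y = x - v"
  define a where "a = Min (range (\<lambda>s. y $ s))"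
  define b where "b = Max (range (\<lambda>s. y $ s))"
  have "a \<in> range (\<lambda>s. y $ s)" "b \<in> range (\<lambda>s. y $ s)" unfolding a_def b_def
    by (intro Min_in Max_in; simp)+
  then have "\<bar>b - a\<bar> \<le> sqrt 2 * norm y" using coordinate_gap_le_norm[of y] by blast
  then have "\<bar>b - a\<bar>\<^sup>2 \<le> (sqrt 2 * norm y)\<^sup>2" by (intro power_mono) auto
  then have gap: "(b - a)\<^sup>2 \<le> 2 * (norm y)\<^sup>2" by (simp add: power_mult_distrib)
  have expand: "(norm (x + (axis s 1 - v)))\<^sup>2 = (norm y)\<^sup>2 + 1 + 2 * y $ s" for s :: 's
  proof -
    have eq: "x + (axis s 1 - v) = y + axis s 1" by (simp add: y_def)
    show ?thesis unfolding eq
      by (simp add: power2_norm_eq_inner inner_add_left inner_add_right inner_axis inner_axis_axis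
          inner_commute[of "axis s 1"])
  qed
  have mean: "measure_pmf.expectation p (\<lambda>s. y $ s) = y \<bullet> v"
    by (subst integral_measure_pmf_real[of UNIV]) (auto simp: inner_vec_def v_def pmf_vec_def)
  have "(\<integral>\<^sup>+s. ennreal (exp ((norm (x + (axis s 1 - v)))\<^sup>2 / c)) \<partial>measure_pmf p)
      = (\<integral>\<^sup>+s. ennreal (exp (((norm y)\<^sup>2 + 1) / c)) * ennreal (exp (2 / c * y $ s)) \<partial>measure_pmf p)"
    by (intro nn_integral_cong) (simp add: expand add_divide_distrib flip: ennreal_mult exp_add)
  also have "\<dots> = ennreal (exp (((norm y)\<^sup>2 + 1) / c)) * (\<integral>\<^sup>+s. ennreal (exp (2 / c * y $ s)) \<partial>measure_pmf p)"
    by (rule nn_integral_cmult) simp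
  also have "\<dots> \<le> ennreal (exp (((norm y)\<^sup>2 + 1) / c)) *
      ennreal (exp (2 / c * (y \<bullet> v) + (2 / c)\<^sup>2 * (b - a)\<^sup>2 / 8))"
    unfolding mean[symmetric] using c
    by (intro mult_left_mono hoeffding_lemma_pmf) (auto simp: a_def b_def)
  also have "\<dots> = ennreal (exp (((norm y)\<^sup>2 + 1) / c + (2 / c * (y \<bullet> v) + (2 / c)\<^sup>2 * (b - a)\<^sup>2 / 8)))"
    by (simp add: exp_add ennreal_mult)
  also have "\<dots> \<le> ennreal (exp (1 / c + (norm x)\<^sup>2 / (c - 1)))"
  proof (intro ennreal_leI, subst exp_le_cancel_iff)
    have "(2 / c)\<^sup>2 * (b - a)\<^sup>2 / 8 \<le> (2 / c)\<^sup>2 * (2 * (norm y)\<^sup>2) / 8"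
      using gap by (intro divide_right_mono mult_left_mono) auto
    also have "\<dots> = (norm y)\<^sup>2 / c\<^sup>2" by (simp add: power_divide)
    finally have "((norm y)\<^sup>2 + 1) / c + (2 / c * (y \<bullet> v) + (2 / c)\<^sup>2 * (b - a)\<^sup>2 / 8)
        \<le> 1 / c + ((norm y)\<^sup>2 + 2 * (y \<bullet> v)) / c + (norm y)\<^sup>2 / c\<^sup>2"
      by (simp add: add_divide_distrib)
    also have "(norm y)\<^sup>2 + 2 * (y \<bullet> v) = (norm x)\<^sup>2 - (norm v)\<^sup>2"
      by (simp add: y_def power2_norm_eq_inner inner_diff_left inner_diff_right inner_commute)
    also have "1 / c + ((norm x)\<^sup>2 - (norm v)\<^sup>2) / c + (norm y)\<^sup>2 / c\<^sup>2 \<le> 1 / c + (norm x)\<^sup>2 / (c - 1)"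
    proof -
      \<comment> \<open>the square whose nonnegativity is Young's inequality with these weights\<close>
      have "0 \<le> (norm (x + (c - 1) *\<^sub>R v))\<^sup>2" by simp
      also have "\<dots> = (norm x)\<^sup>2 + 2 * (c - 1) * (x \<bullet> v) + (c - 1)\<^sup>2 * (norm v)\<^sup>2"
        unfolding power2_norm_eq_inner
        by (simp add: inner_add_left inner_add_right inner_commute power2_eq_square algebra_simps)
      finally have sq: "0 \<le> (norm x)\<^sup>2 + 2 * (c - 1) * (x \<bullet> v) + (c - 1)\<^sup>2 * (norm v)\<^sup>2" .
      have ny: "(norm y)\<^sup>2 = (norm x)\<^sup>2 - 2 * (x \<bullet> v) + (norm v)\<^sup>2"
        by (simp add: y_def power2_norm_eq_inner inner_diff_left inner_diff_right inner_commute)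
      have "(norm x)\<^sup>2 / (c - 1) - ((norm x)\<^sup>2 - (norm v)\<^sup>2) / c - (norm y)\<^sup>2 / c\<^sup>2
          = ((norm x)\<^sup>2 + 2 * (c - 1) * (x \<bullet> v) + (c - 1)\<^sup>2 * (norm v)\<^sup>2) / (c\<^sup>2 * (c - 1))"
        unfolding ny using c by (simp add: divide_simps) (simp add: power2_eq_square algebra_simps)
      also have "\<dots> \<ge> 0" using sq c by (intro divide_nonneg_pos) auto
      finally show ?thesis by simp
    qed
    finally show "((norm y)\<^sup>2 + 1) / c + (2 / c * (y \<bullet> v) + (2 / c)\<^sup>2 * (b - a)\<^sup>2 / 8)
        \<le> 1 / c + (norm x)\<^sup>2 / (c - 1)" .
  qed
  finally show ?thesis unfolding v_def .
qed

section \<open>Exponential supermartingales along the play\<close>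

lemma length_play: "h \<in> set_pmf (play G env fc n) \<Longrightarrow> length h = n"
  by (induction n arbitrary: h) auto

lemma play_outcome_range:
  assumes "environment G env"
  shows "h \<in> set_pmf (play G env fc n) \<Longrightarrow> t \<in> {1..length h} \<Longrightarrow> outcome_at h t \<in> {1..num_outcomes G}"
proof (induction n arbitrary: h t)
  case (Suc n)
  obtain h' j i s where h': "h' \<in> set_pmf (play G env fc n)" "j \<in> set_pmf (env h')" "h = h' @ [(j, i, s)]"
    using Suc.prems(1) by auto
  show ?case
  proof (cases "t \<le> length h'")
    case True
    then have "outcome_at h t = outcome_at h' t"
      using Suc.prems(2) by (auto simp: outcome_at_def h' nth_append)
    then show ?thesis using Suc.IH[OF h'(1), of t] True Suc.prems(2) by simp
  next
    case False
    then have "t = Suc (length h')" using Suc.prems(2) h' by simp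
    then have "outcome_at h t = j" by (simp add: outcome_at_def h')
    then show ?thesis using h'(2) assms unfolding environment_def by blast
  qed
qed simp

lemma append_at [simp]:
  assumes "t \<in> {1..length h}"
  shows "outcome_at (h @ [x]) t = outcome_at h t" "action_at (h @ [x]) t = action_at h t"
    "signal_at (h @ [x]) t = signal_at h t"
  using assms by (auto simp: outcome_at_def action_at_def signal_at_def nth_append)

lemma append_at_last [simp]:
  "outcome_at (h @ [(j, i, s)]) (Suc (length h)) = j"
  "action_at (h @ [(j, i, s)]) (Suc (length h)) = i"
  "signal_at (h @ [(j, i, s)]) (Suc (length h)) = s"
  by (auto simp: outcome_at_def action_at_def signal_at_def)

lemma nn_integral_pmf_le_const:
  assumes "\<And>x. x \<in> set_pmf p \<Longrightarrow> f x \<le> c"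
  shows "(\<integral>\<^sup>+x. f x \<partial>measure_pmf p) \<le> c"
proof -
  have "(\<integral>\<^sup>+x. f x \<partial>measure_pmf p) \<le> (\<integral>\<^sup>+x. c \<partial>measure_pmf p)"
    using assms by (intro nn_integral_mono_AE) (simp add: AE_measure_pmf_iff)
  then show ?thesis by (simp add: measure_pmf.emeasure_space_1)
qed

text \<open>The bound holds whatever the environment does, since the supermartingale
  property is assumed for every possible next outcome \<open>j\<close> and not only on average.\<close>
lemma play_supermartingale_tail:
  fixes F :: "'s history \<Rightarrow> real"
  assumes step: "\<And>h j. length h < n \<Longrightarrow> j \<in> set_pmf (env h) \<Longrightarrow>
      (\<integral>\<^sup>+i. \<integral>\<^sup>+s. ennreal (F (h @ [(j, i, s)])) \<partial>measure_pmf (feedback G j) \<partial>measure_pmf (fc h)) \<le> ennreal (F h)"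
    and init: "F [] \<le> 1" and \<delta>: "\<delta> > 0"
  shows "measure_pmf.prob (play G env fc n) {h. F h \<ge> 1 / \<delta>} \<le> \<delta>"
proof -
  have "k \<le> n \<Longrightarrow> (\<integral>\<^sup>+h. ennreal (F h) \<partial>measure_pmf (play G env fc k)) \<le> 1" for k
  proof (induction k)
    case 0
    then show ?case using init by simp
  next
    case (Suc k)
    have "(\<integral>\<^sup>+h. ennreal (F h) \<partial>measure_pmf (play G env fc (Suc k)))
      = (\<integral>\<^sup>+h. \<integral>\<^sup>+j. \<integral>\<^sup>+i. \<integral>\<^sup>+s. ennreal (F (h @ [(j, i, s)])) \<partial>measure_pmf (feedback G j)
          \<partial>measure_pmf (fc h) \<partial>measure_pmf (env h) \<partial>measure_pmf (play G env fc k))"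
      by simp
    also have "\<dots> \<le> (\<integral>\<^sup>+h. ennreal (F h) \<partial>measure_pmf (play G env fc k))"
    proof (intro nn_integral_mono_AE, unfold AE_measure_pmf_iff, intro ballI, rule nn_integral_pmf_le_const)
      fix h j assume h: "h \<in> set_pmf (play G env fc k)" and j: "j \<in> set_pmf (env h)"
      have "length h < n" using length_play[OF h] Suc.prems by simp
      from step[OF this j] show "(\<integral>\<^sup>+i. \<integral>\<^sup>+s. ennreal (F (h @ [(j, i, s)])) \<partial>measure_pmf (feedback G j)
          \<partial>measure_pmf (fc h)) \<le> ennreal (F h)" .
    qed
    also have "\<dots> \<le> 1" using Suc by simp
    finally show ?case .
  qed
  then have int: "(\<integral>\<^sup>+h. ennreal (F h) \<partial>measure_pmf (play G env fc n)) \<le> 1" by simp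
  have "emeasure (measure_pmf (play G env fc n)) {h. F h \<ge> 1 / \<delta>}
      \<le> emeasure (measure_pmf (play G env fc n)) {h \<in> UNIV. 1 \<le> ennreal \<delta> * ennreal (F h)}"
  proof (intro emeasure_mono subsetI)
    fix h assume "h \<in> {h. F h \<ge> 1 / \<delta>}"
    then have "1 \<le> \<delta> * F h" using \<delta> by (simp add: field_simps)
    then have "ennreal 1 \<le> ennreal (\<delta> * F h)" by (rule ennreal_leI)
    then show "h \<in> {h \<in> UNIV. 1 \<le> ennreal \<delta> * ennreal (F h)}"
      using \<delta> by (simp add: ennreal_mult')
  qed simp
  also have "\<dots> \<le> ennreal \<delta> * (\<integral>\<^sup>+h. ennreal (F h) * indicator UNIV h \<partial>measure_pmf (play G env fc n))"
    by (rule nn_integral_Markov_inequality) auto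
  also have "\<dots> \<le> ennreal \<delta> * 1" using int by (intro mult_left_mono) auto
  finally show ?thesis using \<delta> by (simp add: measure_pmf.emeasure_eq_measure)
qed

text \<open>Only the rounds of \<open>T\<close> that have already been played contribute, so that this is an adapted
  process along the growing history.\<close>
definition deviation :: "('s::finite) game \<Rightarrow> nat set \<Rightarrow> 's history \<Rightarrow> real ^ 's" where
  "deviation G T h = (\<Sum>t\<in>T \<inter> {1..length h}. axis (signal_at h t) 1 - pmf_vec (feedback G (outcome_at h t)))"

lemma deviation_append:
  "deviation G T (h @ [(j, i, s)]) =
     deviation G T h + (if Suc (length h) \<in> T then axis s 1 - pmf_vec (feedback G j) else 0)"
proof -
  have "T \<inter> {1..length (h @ [(j, i, s)])} =
      T \<inter> {1..length h} \<union> (if Suc (length h) \<in> T then {Suc (length h)} else {})"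
    by (auto simp: le_Suc_eq Suc_le_eq)
  then show ?thesis
    unfolding deviation_def by (auto simp del: One_nat_def simp: add.commute intro!: sum.cong)
qed

lemma harmonic_tail_le_ln2:
  assumes m: "m \<ge> 1"
  shows "(\<Sum>i=1..k. 1 / (real m + real i)) \<le> ln (real (m + k) / real m)"
proof (induction k)
  case 0
  then show ?case using m by simp
next
  case (Suc k)
  let ?a = "real (m + k)" and ?b = "real (m + Suc k)"
  have a: "?a > 0" using m by simp
  have "ln (?a / ?b) \<le> ?a / ?b - 1" using a by (intro ln_le_minus_one) simp
  also have "?a / ?b - 1 = - (1 / ?b)" by (simp add: field_simps)
  finally have "1 / ?b \<le> ln ?b - ln ?a" using a by (simp add: ln_div)
  moreover have "ln (?b / real m) = ln ?b - ln (real m)" "ln (?a / real m) = ln ?a - ln (real m)"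
    using m a by (simp_all only: ln_div of_nat_0_less_iff) (simp_all add: ln_div)
  ultimately show ?case using Suc by (simp add: add_ac)
qed

text \<open>When \<open>k\<close> rounds of \<open>T\<close> have been played, the supermartingale is \<open>exp (norm x ^ 2 / (m + k))\<close>, at the
  deviation \<open>x\<close>, divided by the product of the factors \<open>exp (1 / (m + i))\<close> for \<open>i \<le> k\<close>. It starts at 1, and the
  product never exceeds 2.\<close>
lemma deviation_tail:
  fixes G :: "('s::finite) game"
  assumes T: "T \<subseteq> {1..n}" and m: "card T = m" "m \<ge> 1" and \<delta>: "0 < \<delta>" "\<delta> < 1"
  shows "measure_pmf.prob (play G env fc n) {h. norm (deviation G T h) > sqrt (2 * real m * ln (2 / \<delta>))} \<le> \<delta>"
proof -
  define k where "k h = card (T \<inter> {1..length h})" for h :: "'s history"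
  define F where "F h = exp ((norm (deviation G T h))\<^sup>2 / (real m + real (k h)) - (\<Sum>i=1..k h. 1 / (real m + real i)))"
    for h
  have finT: "finite T" using T by (rule finite_subset) simp
  have k_append: "k (h @ [x]) = (if Suc (length h) \<in> T then Suc (k h) else k h)" for h x
  proof -
    have "T \<inter> {1..length (h @ [x])} =
        (if Suc (length h) \<in> T then insert (Suc (length h)) (T \<inter> {1..length h}) else T \<inter> {1..length h})"
      by (auto simp: le_Suc_eq Suc_le_eq)
    then show ?thesis unfolding k_def by simp
  qed
  have step: "(\<integral>\<^sup>+i. \<integral>\<^sup>+s. ennreal (F (h @ [(j, i, s)])) \<partial>measure_pmf (feedback G j) \<partial>measure_pmf (fc h)) \<le> ennreal (F h)"
    for h j
  proof (cases "Suc (length h) \<in> T")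
    case False
    then have "F (h @ [(j, i, s)]) = F h" for i s
      by (simp add: F_def k_append deviation_append)
    then show ?thesis by (simp add: measure_pmf.emeasure_space_1)
  next
    case True
    let ?x = "deviation G T h" and ?c = "real m + real (k h) + 1"
    let ?H = "exp (- (\<Sum>i=1..Suc (k h). 1 / (real m + real i)))"
    have c: "?c > 1" using m(2) by simp
    have "F (h @ [(j, i, s)]) = ?H * exp ((norm (?x + (axis s 1 - pmf_vec (feedback G j))))\<^sup>2 / ?c)" for i s
      unfolding F_def k_append deviation_append using True
      by (simp add: add_ac flip: exp_add)
    then have "(\<integral>\<^sup>+i. \<integral>\<^sup>+s. ennreal (F (h @ [(j, i, s)])) \<partial>measure_pmf (feedback G j) \<partial>measure_pmf (fc h))
      = ennreal ?H * (\<integral>\<^sup>+s. ennreal (exp ((norm (?x + (axis s 1 - pmf_vec (feedback G j))))\<^sup>2 / ?c)) \<partial>measure_pmf (feedback G j))"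
      by (simp only: ennreal_mult' exp_ge_zero) (simp add: nn_integral_cmult measure_pmf.emeasure_space_1)
    also have "\<dots> \<le> ennreal ?H * ennreal (exp (1 / ?c + (norm ?x)\<^sup>2 / (?c - 1)))"
      by (intro mult_left_mono square_exponential_step c) simp
    also have "\<dots> = ennreal (?H * exp (1 / ?c + (norm ?x)\<^sup>2 / (?c - 1)))" by (simp add: ennreal_mult')
    also have "?H * exp (1 / ?c + (norm ?x)\<^sup>2 / (?c - 1)) = F h"
      by (simp add: F_def add.assoc add.commute[of 1] flip: exp_add)
    finally show ?thesis .
  qed
  have "F [] \<le> 1" by (simp add: F_def k_def deviation_def)
  from play_supermartingale_tail[OF step this \<delta>(1)]
  have tail: "measure_pmf.prob (play G env fc n) {h. F h \<ge> 1 / \<delta>} \<le> \<delta>" by blast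
  have "measure_pmf.prob (play G env fc n) {h. norm (deviation G T h) > sqrt (2 * real m * ln (2 / \<delta>))}
      \<le> measure_pmf.prob (play G env fc n) {h. F h \<ge> 1 / \<delta>}"
  proof (rule measure_pmf.finite_measure_mono_AE)
    show "AE h in measure_pmf (play G env fc n).
        h \<in> {h. norm (deviation G T h) > sqrt (2 * real m * ln (2 / \<delta>))} \<longrightarrow> h \<in> {h. F h \<ge> 1 / \<delta>}"
      unfolding AE_measure_pmf_iff mem_Collect_eq
    proof (intro ballI impI)
      fix h assume "h \<in> set_pmf (play G env fc n)"
        and big: "norm (deviation G T h) > sqrt (2 * real m * ln (2 / \<delta>))"
      then have "length h = n" by (simp add: length_play)
      then have kh: "k h = m" using T m(1) by (simp add: k_def Int_absorb2)
      have l0: "ln (2 / \<delta>) > 0" using \<delta> by simp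
      have "(sqrt (2 * real m * ln (2 / \<delta>)))\<^sup>2 \<le> (norm (deviation G T h))\<^sup>2"
        using big l0 by (intro power_mono) auto
      then have "2 * real m * ln (2 / \<delta>) \<le> (norm (deviation G T h))\<^sup>2" using l0 by simp
      then have "ln (2 / \<delta>) \<le> (norm (deviation G T h))\<^sup>2 / (real m + real m)"
        using m(2) by (simp add: field_simps)
      moreover have "(\<Sum>i=1..m. 1 / (real m + real i)) \<le> ln 2"
        using harmonic_tail_le_ln2[OF m(2), of m] m(2) by simp
      moreover have "ln (2 / \<delta>) = ln 2 + ln (1 / \<delta>)" using \<delta> by (simp add: ln_div)
      ultimately have "exp (ln (1 / \<delta>)) \<le> F h"
        unfolding F_def kh by (subst exp_le_cancel_iff) linarith
      then show "1 / \<delta> \<le> F h" using \<delta> by simp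
    qed
  qed simp
  with tail show ?thesis by linarith
qed

text \<open>The conditional mean of the reward of round \<open>t\<close>, given the history before this round and the
  outcome.\<close>
definition expected_reward :: "'s game \<Rightarrow> ('s history \<Rightarrow> nat pmf) \<Rightarrow> 's history \<Rightarrow> nat \<Rightarrow> real" where
  "expected_reward G fc h t =
     measure_pmf.expectation (fc (take (t - 1) h)) (\<lambda>i. reward G i (outcome_at h t))"

definition reward_shortfall :: "'s game \<Rightarrow> ('s history \<Rightarrow> nat pmf) \<Rightarrow> 's history \<Rightarrow> real" where
  "reward_shortfall G fc h =
     (\<Sum>t=1..length h. expected_reward G fc h t - reward G (action_at h t) (outcome_at h t))"

lemma reward_shortfall_append:
  "reward_shortfall G fc (h @ [(j, i, s)]) = reward_shortfall G fc h +
     (measure_pmf.expectation (fc h) (\<lambda>i. reward G i j) - reward G i j)"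
proof -
  have "(\<Sum>t=1..length h. expected_reward G fc (h @ [(j, i, s)]) t
      - reward G (action_at (h @ [(j, i, s)]) t) (outcome_at (h @ [(j, i, s)]) t)) = reward_shortfall G fc h"
    unfolding reward_shortfall_def expected_reward_def
    by (intro sum.cong refl) (auto simp del: One_nat_def)
  then show ?thesis
    unfolding reward_shortfall_def[of G fc "h @ _"] by (simp add: expected_reward_def)
qed

text \<open>The Azuma inequality: the increments are centred and, given the past and the outcome, range over an
  interval of length 1.\<close>
lemma reward_shortfall_tail:
  fixes G :: "'s game"
  assumes G: "valid_game G" and env: "environment G env"
    and fc: "\<And>h. set_pmf (fc h) \<subseteq> {1..num_actions G}"
    and n: "n \<ge> 1" and \<delta>: "0 < \<delta>" "\<delta> < 1"
  shows "measure_pmf.prob (play G env fc n) {h. reward_shortfall G fc h > sqrt (real n * ln (1 / \<delta>) / 2)} \<le> \<delta>"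
proof -
  define u where "u = sqrt (real n * ln (1 / \<delta>) / 2)"
  have u: "u > 0" "u\<^sup>2 = real n * ln (1 / \<delta>) / 2" using \<delta> n by (auto simp: u_def)
  \<comment> \<open>the minimiser of \<open>l\<^sup>2 * n / 8 - l * u\<close>\<close>
  define l where "l = 4 * u / real n"
  have l: "l > 0" using u n by (simp add: l_def)
  define F where "F h = exp (l * reward_shortfall G fc h - l\<^sup>2 * real (length h) / 8)" for h
  have step: "(\<integral>\<^sup>+i. \<integral>\<^sup>+s. ennreal (F (h @ [(j, i, s)])) \<partial>measure_pmf (feedback G j) \<partial>measure_pmf (fc h)) \<le> ennreal (F h)"
    if j: "j \<in> set_pmf (env h)" for h j
  proof -
    have jM: "j \<in> {1..num_outcomes G}" using j env unfolding environment_def by blast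
    let ?\<mu> = "measure_pmf.expectation (fc h) (\<lambda>i. reward G i j)"
    let ?H = "F h * exp (- (l\<^sup>2 / 8) + l * ?\<mu>)"
    have "F (h @ [(j, i, s)]) = ?H * exp (l * - reward G i j)" for i s
      unfolding F_def reward_shortfall_append by (simp add: algebra_simps add_divide_distrib flip: exp_add)
    then have "(\<integral>\<^sup>+i. \<integral>\<^sup>+s. ennreal (F (h @ [(j, i, s)])) \<partial>measure_pmf (feedback G j) \<partial>measure_pmf (fc h))
       = (\<integral>\<^sup>+i. ennreal ?H * ennreal (exp (l * - reward G i j)) \<partial>measure_pmf (fc h))"
      by (simp add: measure_pmf.emeasure_space_1 ennreal_mult' F_def)
    also have "\<dots> = ennreal ?H * (\<integral>\<^sup>+i. ennreal (exp (l * - reward G i j)) \<partial>measure_pmf (fc h))"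
      by (rule nn_integral_cmult) simp
    also have "\<dots> \<le> ennreal ?H * ennreal (exp (l * measure_pmf.expectation (fc h) (\<lambda>i. - reward G i j)
        + l\<^sup>2 * (0 - (-1))\<^sup>2 / 8))"
    proof (intro mult_left_mono hoeffding_lemma_pmf l)
      fix i assume "i \<in> set_pmf (fc h)"
      then have "i \<in> {1..num_actions G}" using fc by blast
      then show "-1 \<le> - reward G i j \<and> - reward G i j \<le> 0"
        using G jM by (auto simp: valid_game_def)
    qed simp
    also have "\<dots> = ennreal (?H * exp (l * - ?\<mu> + l\<^sup>2 / 8))"
      by (simp add: ennreal_mult' F_def)
    also have "?H * exp (l * - ?\<mu> + l\<^sup>2 / 8) = F h"
      by (simp add: mult.assoc flip: exp_add)
    finally show ?thesis .
  qed
  have "F [] \<le> 1" by (simp add: F_def reward_shortfall_def)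
  from play_supermartingale_tail[OF step this \<delta>(1)]
  have tail: "measure_pmf.prob (play G env fc n) {h. F h \<ge> 1 / \<delta>} \<le> \<delta>" by blast
  have "measure_pmf.prob (play G env fc n) {h. reward_shortfall G fc h > u}
      \<le> measure_pmf.prob (play G env fc n) {h. F h \<ge> 1 / \<delta>}"
  proof (rule measure_pmf.finite_measure_mono_AE)
    show "AE h in measure_pmf (play G env fc n).
        h \<in> {h. reward_shortfall G fc h > u} \<longrightarrow> h \<in> {h. F h \<ge> 1 / \<delta>}"
      unfolding AE_measure_pmf_iff mem_Collect_eq
    proof (intro ballI impI)
      fix h assume "h \<in> set_pmf (play G env fc n)" and big: "reward_shortfall G fc h > u"
      then have len: "length h = n" by (simp add: length_play)
      have "ln (1 / \<delta>) = l * u - l\<^sup>2 * real n / 8"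
      proof -
        have "l * u - l\<^sup>2 * real n / 8 = 2 * u\<^sup>2 / real n"
          using n by (simp add: l_def power2_eq_square field_simps)
        then show ?thesis using n u(2) by simp
      qed
      also have "\<dots> \<le> l * reward_shortfall G fc h - l\<^sup>2 * real n / 8"
        using big l by simp
      finally have "exp (ln (1 / \<delta>)) \<le> F h" unfolding F_def len by (subst exp_le_cancel_iff)
      then show "1 / \<delta> \<le> F h" using \<delta> by simp
    qed
  qed simp
  with tail show ?thesis unfolding u_def by linarith
qed

section \<open>Averages over blocks of rounds\<close>

definition point :: "nat \<Rightarrow> nat \<Rightarrow> real" where
  "point j = (\<lambda>i. if i = j then 1 else 0)"

lemma point_in_prob_simplex: "j \<in> {1..d} \<Longrightarrow> point j \<in> prob_simplex d"
  by (auto simp: point_def prob_simplex_def sum.delta)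

lemma mixed_feedback_point:
  "j \<in> {1..num_outcomes G} \<Longrightarrow> mixed_feedback G (point j) = pmf_vec (feedback G j)"
  by (simp add: mixed_feedback_def point_def pmf_vec_def if_distrib[of "\<lambda>x. x *\<^sub>R _"] sum.delta cong: if_cong)

lemma mixed_reward_point:
  "j \<in> {1..num_outcomes G} \<Longrightarrow> mixed_reward G p (point j) = (\<Sum>i=1..num_actions G. p i * reward G i j)"
  by (simp add: mixed_reward_def point_def if_distrib[of "\<lambda>x. _ * x"] if_distrib[of "\<lambda>x. x * _"] sum.delta cong: if_cong)

definition round_average :: "nat set \<Rightarrow> 's history \<Rightarrow> nat \<Rightarrow> real" where
  "round_average T h = (\<lambda>j. \<Sum>t\<in>T. (1 / real (card T)) * point (outcome_at h t) j)"

lemma empirical_eq_round_average: "empirical h = round_average {1..length h} h"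
proof
  fix j
  have "(\<Sum>t\<in>{1..length h}. point (outcome_at h t) j) = (\<Sum>t\<in>{1..length h}. if outcome_at h t = j then 1 else 0)"
    by (intro sum.cong) (auto simp: point_def)
  also have "\<dots> = real (card {t \<in> {1..length h}. outcome_at h t = j})"
    by (simp add: sum.If_cases Int_def)
  finally show "empirical h j = round_average {1..length h} h j"
    by (simp add: empirical_def round_average_def flip: sum_divide_distrib)
qed

lemma round_average:
  assumes T: "finite T" "T \<noteq> {}" and out: "\<And>t. t \<in> T \<Longrightarrow> outcome_at h t \<in> {1..num_outcomes G}"
  shows "round_average T h \<in> prob_simplex (num_outcomes G)"
    "mixed_feedback G (round_average T h) = (1 / real (card T)) *\<^sub>R (\<Sum>t\<in>T. pmf_vec (feedback G (outcome_at h t)))"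
    "mixed_reward G p (round_average T h) = (1 / real (card T)) * (\<Sum>t\<in>T. mixed_reward G p (point (outcome_at h t)))"
proof -
  show "round_average T h \<in> prob_simplex (num_outcomes G)" unfolding round_average_def
    using T out by (intro convex_combination_in_prob_simplex point_in_prob_simplex) auto
  show "mixed_feedback G (round_average T h) = (1 / real (card T)) *\<^sub>R (\<Sum>t\<in>T. pmf_vec (feedback G (outcome_at h t)))"
    unfolding round_average_def mixed_feedback_sum scaleR_sum_right
    using out by (intro sum.cong) (auto simp: mixed_feedback_point)
  show "mixed_reward G p (round_average T h) = (1 / real (card T)) * (\<Sum>t\<in>T. mixed_reward G p (point (outcome_at h t)))"
    unfolding round_average_def mixed_reward_sum sum_distrib_left ..
qed

definition block :: "nat \<Rightarrow> nat \<Rightarrow> nat set" where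
  "block m b = {b * m + 1..(b + 1) * m}"

lemma card_block [simp]: "card (block m b) = m" and finite_block [simp]: "finite (block m b)"
  by (simp_all add: block_def)

lemma block_nonempty: "m \<ge> 1 \<Longrightarrow> block m b \<noteq> {}"
  by (simp add: block_def)

lemma block_subset: assumes "b < B" "B * m \<le> n" shows "block m b \<subseteq> {1..n}"
proof -
  have "(b + 1) * m \<le> B * m" using assms(1) by (intro mult_right_mono) auto
  with assms(2) have le: "(b + 1) * m \<le> n" by (rule le_trans[rotated])
  show ?thesis
  proof
    fix t assume "t \<in> block m b"
    then have "b * m + 1 \<le> t" "t \<le> (b + 1) * m" by (simp_all only: block_def atLeastAtMost_iff)
    with le show "t \<in> {1..n}" unfolding atLeastAtMost_iff by linarith
  qed
qed

lemma block_index: assumes "t \<in> block m b" shows "(t - 1) div m = b"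
proof -
  have "b * m \<le> t - 1" "t - 1 < Suc b * m" using assms by (auto simp: block_def)
  then show ?thesis by (intro div_nat_eqI) (simp_all add: mult.commute)
qed

lemma sum_blocks: "(\<Sum>t=1..B * m. f t) = (\<Sum>b<B. \<Sum>t\<in>block m b. (f t :: 'a :: comm_monoid_add))"
proof (induction B)
  case (Suc B)
  have "{1..Suc B * m} = {1..B * m} \<union> block m B" "{1..B * m} \<inter> block m B = {}"
    by (auto simp: block_def)
  then show ?case using Suc by (simp add: sum.union_disjoint)
qed simp

lemma sum_rounds_split:
  fixes f :: "nat \<Rightarrow> 'a :: comm_monoid_add"
  assumes "B * m \<le> n"
  shows "(\<Sum>t=1..n. f t) = (\<Sum>b<B. \<Sum>t\<in>block m b. f t) + (\<Sum>t\<in>{B * m<..n}. f t)"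
proof -
  have "{1..n} = {1..B * m} \<union> {B * m<..n}" using assms by auto
  moreover have "{1..B * m} \<inter> {B * m<..n} = {}" by auto
  ultimately have "(\<Sum>t=1..n. f t) = (\<Sum>t=1..B * m. f t) + (\<Sum>t\<in>{B * m<..n}. f t)"
    by (metis finite_atLeastAtMost finite_greaterThanAtMost sum.union_disjoint)
  then show ?thesis by (simp only: sum_blocks)
qed

text \<open>The competitor \<open>z\<close> for the empirical feedback replaces every outcome in a full block by a minimising
  law for the mean feedback of that block and keeps the outcomes of the remaining rounds, each of which has
  reward at most 1.\<close>
lemma rho_block_convexity:
  assumes G: "valid_game G" and p: "p \<in> prob_simplex (num_actions G)"
    and n: "length h \<ge> 1" and m: "m \<ge> 1" and B: "B * m \<le> length h"
    and out: "\<And>t. t \<in> {1..length h} \<Longrightarrow> outcome_at h t \<in> {1..num_outcomes G}"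
  shows "real (length h) * rho G p (mixed_feedback G (empirical h))
    \<le> real m * (\<Sum>b<B. rho G p (mixed_feedback G (round_average (block m b) h)))
      + (real (length h) - real (B * m))"
proof -
  let ?n = "length h" and ?M = "num_outcomes G"
  let ?\<Delta> = "\<lambda>b. mixed_feedback G (round_average (block m b) h)"
  have out_block: "outcome_at h t \<in> {1..?M}" if "b < B" "t \<in> block m b" for b t
    using out block_subset[OF that(1) B] that(2) by blast
  note avg = round_average[OF finite_block block_nonempty[OF m] out_block]
  have feas: "?\<Delta> b \<in> feasible G" if "b < B" for b
    using avg(1)[OF that] by (auto simp: feasible_def)
  have "\<exists>q. b < B \<longrightarrow> q \<in> prob_simplex ?M \<and> mixed_feedback G q = ?\<Delta> b \<and> rho G p (?\<Delta> b) = mixed_reward G p q" for b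
    using rho_attained[OF feas, of b p] by blast
  then obtain q where "\<forall>b. b < B \<longrightarrow> q b \<in> prob_simplex ?M \<and> mixed_feedback G (q b) = ?\<Delta> b \<and>
      rho G p (?\<Delta> b) = mixed_reward G p (q b)"
    using choice[of "\<lambda>b q. b < B \<longrightarrow> q \<in> prob_simplex ?M \<and> mixed_feedback G q = ?\<Delta> b \<and>
      rho G p (?\<Delta> b) = mixed_reward G p q"] by blast
  then have q: "\<And>b. b < B \<Longrightarrow> q b \<in> prob_simplex ?M" "\<And>b. b < B \<Longrightarrow> mixed_feedback G (q b) = ?\<Delta> b"
    "\<And>b. b < B \<Longrightarrow> rho G p (?\<Delta> b) = mixed_reward G p (q b)" by blast+
  define x where "x t = (if t \<le> B * m then q ((t - 1) div m) else point (outcome_at h t))" for t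
  have x_block: "x t = q b" if "b < B" "t \<in> block m b" for b t
  proof -
    have "t \<in> {1..B * m}" using block_subset[OF that(1), of m "B * m"] that(2) by blast
    then show ?thesis using block_index[OF that(2)] by (simp add: x_def)
  qed
  have x_simplex: "x t \<in> prob_simplex ?M" if t: "t \<in> {1..?n}" for t
  proof (cases "t \<le> B * m")
    case True
    have "t - 1 < B * m" using True t by (cases t) auto
    then have "(t - 1) div m < B" by (simp add: less_mult_imp_div_less)
    then show ?thesis using True q(1) by (simp add: x_def)
  next
    case False
    then show ?thesis using out[OF t] point_in_prob_simplex by (simp add: x_def)
  qed
  note split = sum_rounds_split[OF B]
  define z where "z j = (\<Sum>t=1..?n. (1 / real ?n) * x t j)" for j
  have z: "z \<in> prob_simplex ?M" unfolding z_def
    using n x_simplex by (intro convex_combination_in_prob_simplex) auto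
  have "(\<Sum>t\<in>block m b. mixed_feedback G (x t)) = (\<Sum>t\<in>block m b. pmf_vec (feedback G (outcome_at h t)))"
    if b: "b < B" for b
  proof -
    have "(\<Sum>t\<in>block m b. mixed_feedback G (x t)) = real m *\<^sub>R ?\<Delta> b"
      using b by (simp add: x_block q(2) sum_constant_scaleR del: sum_constant)
    also have "\<dots> = (\<Sum>t\<in>block m b. pmf_vec (feedback G (outcome_at h t)))"
      using m by (simp add: avg(2)[OF b])
    finally show ?thesis .
  qed
  moreover have "mixed_feedback G (x t) = pmf_vec (feedback G (outcome_at h t))"
    if "t \<in> {B * m<..?n}" for t
    using mixed_feedback_point[OF out[of t]] that by (auto simp: x_def)
  ultimately have "(\<Sum>t=1..?n. mixed_feedback G (x t)) = (\<Sum>t=1..?n. pmf_vec (feedback G (outcome_at h t)))"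
    unfolding split by simp
  moreover have "{1..?n} \<noteq> {}" using n by simp
  ultimately have Hz: "mixed_feedback G z = mixed_feedback G (empirical h)"
    unfolding z_def mixed_feedback_sum empirical_eq_round_average
    using round_average(2)[of "{1..?n}" h G] out by (simp flip: scaleR_sum_right)
  have "real ?n * rho G p (mixed_feedback G (empirical h)) \<le> real ?n * mixed_reward G p z"
    using rho_le[OF z Hz] by (intro mult_left_mono) auto
  also have "\<dots> = (\<Sum>t=1..?n. mixed_reward G p (x t))"
    unfolding z_def mixed_reward_sum using n by (simp flip: sum_distrib_left sum_divide_distrib)
  also have "\<dots> = (\<Sum>b<B. \<Sum>t\<in>block m b. mixed_reward G p (x t)) + (\<Sum>t\<in>{B * m<..?n}. mixed_reward G p (x t))"
    by (rule split)
  also have "(\<Sum>b<B. \<Sum>t\<in>block m b. mixed_reward G p (x t)) = real m * (\<Sum>b<B. rho G p (?\<Delta> b))"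
    unfolding sum_distrib_left by (intro sum.cong refl) (simp add: x_block q(3))
  also have "(\<Sum>t\<in>{B * m<..?n}. mixed_reward G p (x t)) \<le> (\<Sum>t\<in>{B * m<..?n}. 1)"
    using x_simplex by (intro sum_mono mixed_reward_bounds[OF G p]) auto
  also have "\<dots> = real ?n - real (B * m)" using B by (simp add: of_nat_diff)
  finally show ?thesis by simp
qed

section \<open>The strategy of the forecaster\<close>

lemma weights_pos: "weights G rt m \<eta> s b k > 0"
  by (induction b arbitrary: k) simp_all

lemma weights_cong:
  assumes "\<And>t. t \<in> {1..b * m} \<Longrightarrow> s t = s' t"
  shows "weights G rt m \<eta> s b = weights G rt m \<eta> s' b"
  using assms
proof (induction b)
  case (Suc b)
  have "weights G rt m \<eta> s b = weights G rt m \<eta> s' b" using Suc by simp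
  moreover have "Delta_hat G m s b = Delta_hat G m s' b"
  proof -
    have "(\<Sum>t=b * m + 1..(b + 1) * m. axis (s t) 1 :: real ^ 'a) = (\<Sum>t=b * m + 1..(b + 1) * m. axis (s' t) 1)"
    proof (intro sum.cong refl)
      fix t assume "t \<in> {b * m + 1..(b + 1) * m}"
      then have "s t = s' t" by (intro Suc.prems) auto
      then show "axis (s t) (1 :: real) = axis (s' t) 1" by simp
    qed
    then show ?thesis unfolding Delta_hat_def by (simp only:)
  qed
  ultimately show ?case by simp
qed simp

definition block_strategy where
  "block_strategy G rt m \<eta> s b = normalized (num_actions G) (weights G rt m \<eta> s b)"

lemma block_strategy:
  assumes "valid_game G"
  shows "block_strategy G rt m \<eta> s b \<in> prob_simplex (num_actions G)"
    "k \<in> {1..num_actions G} \<Longrightarrow> block_strategy G rt m \<eta> s b k > 0"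
  unfolding block_strategy_def using assms
  by (simp_all add: normalized_in_prob_simplex weights_pos valid_game_def del: One_nat_def)

lemma forecaster_eq: "forecaster G rt m \<eta> h = embed_pmf (block_strategy G rt m \<eta> (signal_at h) (length h div m))"
  by (simp add: forecaster_def block_strategy_def)

lemma set_forecaster: "valid_game G \<Longrightarrow> set_pmf (forecaster G rt m \<eta> h) \<subseteq> {1..num_actions G}"
  unfolding forecaster_eq by (intro pmf_embed_prob_simplex(2) block_strategy)

text \<open>The weights of block \<open>b\<close> only see signals of earlier blocks, so they can be computed from the complete
  history instead of the history before round \<open>t\<close>.\<close>
lemma expected_reward_forecaster:
  assumes G: "valid_game G" and t: "t \<in> block m b" "t \<le> length h"
    and out: "outcome_at h t \<in> {1..num_outcomes G}"
  shows "expected_reward G (forecaster G rt m \<eta>) h t =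
    mixed_reward G (block_strategy G rt m \<eta> (signal_at h) b) (point (outcome_at h t))"
proof -
  let ?h = "take (t - 1) h"
  have len: "length ?h = t - 1" using t by simp
  have "weights G rt m \<eta> (signal_at ?h) b = weights G rt m \<eta> (signal_at h) b"
  proof (rule weights_cong)
    fix u assume "u \<in> {1..b * m}"
    then have "u - 1 < t - 1" using t by (auto simp: block_def)
    then show "signal_at ?h u = signal_at h u" by (simp add: signal_at_def)
  qed
  then have "block_strategy G rt m \<eta> (signal_at ?h) b = block_strategy G rt m \<eta> (signal_at h) b"
    by (simp add: block_strategy_def)
  then have "forecaster G rt m \<eta> ?h = embed_pmf (block_strategy G rt m \<eta> (signal_at h) b)"
    unfolding forecaster_eq len block_index[OF t(1)] by simp
  then show ?thesis
    unfolding expected_reward_def mixed_reward_point[OF out]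
    using expectation_embed_prob_simplex[OF block_strategy(1)[OF G]] by simp
qed

lemma feasible_compact: "compact (feasible G)"
  unfolding feasible_def by (intro compact_continuous_image continuous_mixed_feedback compact_prob_simplex)

lemma feasible_convex:
  fixes G :: "('s::finite) game"
  shows "convex (feasible G)"
proof (rule convexI)
  fix x y :: "real ^ 's" and u v :: real
  assume "x \<in> feasible G" "y \<in> feasible G" and uv: "0 \<le> u" "0 \<le> v" "u + v = 1"
  then obtain q q' where q: "q \<in> prob_simplex (num_outcomes G)" "x = mixed_feedback G q"
    "q' \<in> prob_simplex (num_outcomes G)" "y = mixed_feedback G q'"
    by (auto simp: feasible_def)
  define a where "a b = (if b then u else v)" for b
  define z where "z b = (if b then q else q')" for b
  have "(\<lambda>j. \<Sum>b\<in>UNIV. a b * z b j) \<in> prob_simplex (num_outcomes G)"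
    using q uv by (intro convex_combination_in_prob_simplex) (auto simp: a_def z_def UNIV_bool)
  moreover have "mixed_feedback G (\<lambda>j. \<Sum>b\<in>UNIV. a b * z b j) = u *\<^sub>R x + v *\<^sub>R y"
    unfolding mixed_feedback_sum using q by (simp add: a_def z_def UNIV_bool add.commute)
  ultimately show "u *\<^sub>R x + v *\<^sub>R y \<in> feasible G" unfolding feasible_def by (intro image_eqI[OF sym])
qed

lemma Delta_hat_feasible: "valid_game G \<Longrightarrow> Delta_hat G m s b \<in> feasible G"
  unfolding Delta_hat_def by (intro closest_point_in_set compact_imp_closed feasible_compact feasible_nonempty)

text \<open>The mean feedback of the block is feasible, hence fixed by the projection, and projecting does not
  increase distances.\<close>
lemma Delta_hat_error:
  assumes G: "valid_game G" and m: "m \<ge> 1" and sub: "block m b \<subseteq> {1..length h}"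
    and out: "\<And>t. t \<in> {1..length h} \<Longrightarrow> outcome_at h t \<in> {1..num_outcomes G}"
  shows "dist (Delta_hat G m (signal_at h) b) (mixed_feedback G (round_average (block m b) h))
    \<le> norm (deviation G (block m b) h) / real m"
proof -
  let ?\<Delta> = "mixed_feedback G (round_average (block m b) h)"
  let ?s = "(1 / real m) *\<^sub>R (\<Sum>t\<in>block m b. axis (signal_at h t) 1) :: real ^ 'a"
  have out_block: "outcome_at h t \<in> {1..num_outcomes G}" if "t \<in> block m b" for t
    using out sub that by blast
  note avg = round_average[OF finite_block block_nonempty[OF m] out_block]
  have "?\<Delta> \<in> feasible G" using avg(1) by (auto simp: feasible_def)
  then have "closest_point (feasible G) ?\<Delta> = ?\<Delta>" by (rule closest_point_self)
  then have "dist (Delta_hat G m (signal_at h) b) ?\<Delta> \<le> dist ?s ?\<Delta>"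
    using closest_point_lipschitz[OF feasible_convex compact_imp_closed[OF feasible_compact] feasible_nonempty[OF G], of ?s ?\<Delta>]
    by (simp add: Delta_hat_def block_def)
  also have "?s - ?\<Delta> = (1 / real m) *\<^sub>R deviation G (block m b) h"
    using sub by (simp add: avg(2) deviation_def Int_absorb2 sum_subtractf scaleR_diff_right)
  then have "dist ?s ?\<Delta> = norm (deviation G (block m b) h) / real m"
    by (simp add: dist_norm)
  finally show ?thesis .
qed

text \<open>Each difference is at most the inner product of the sub-gradient with \<open>y - p\<^sub>b\<close>; since the mixed actions
  of the forecaster are interior, the gains lie within \<open>K_const G\<close> of some centre, as the exponential weights
  bound requires.\<close>
lemma estimated_rho_regret:
  assumes G: "valid_game G" and rt: "subgradient_selection G rt" and \<eta>: "\<eta> > 0"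
    and y: "y \<in> prob_simplex (num_actions G)"
  shows "(\<Sum>b<B. rho G y (Delta_hat G m s b) - rho G (block_strategy G rt m \<eta> s b) (Delta_hat G m s b))
    \<le> ln (real (num_actions G)) / \<eta> + real B * ((K_const G)\<^sup>2 * \<eta> / 2)"
proof -
  let ?N = "num_actions G" and ?p = "block_strategy G rt m \<eta> s" and ?D = "Delta_hat G m s"
  define g where "g b = rt (?p b) (?D b)" for b
  have sub: "g b \<in> subgradients ?N (prob_simplex ?N) (\<lambda>x. rho G x (?D b)) (?p b)" for b
    using rt block_strategy(1)[OF G] Delta_hat_feasible[OF G] unfolding subgradient_selection_def g_def by blast
  have "(\<Sum>b<B. rho G y (?D b) - rho G (?p b) (?D b)) \<le> (\<Sum>b<B. \<Sum>k=1..?N. g b k * (y k - ?p b k))"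
    using sub y unfolding subgradients_def by (intro sum_mono) blast
  also have "\<dots> \<le> ln (real ?N) / \<eta> + real B * ((K_const G)\<^sup>2 * \<eta> / 2)"
    unfolding block_strategy_def
  proof (rule exponential_weights_regret[OF _ \<eta> _ _ _ y])
    show "?N \<ge> 1" using G by (simp add: valid_game_def)
    show "weights G rt m \<eta> s (Suc b) k = weights G rt m \<eta> s b k * exp (\<eta> * g b k)" for b k
      by (simp add: g_def block_strategy_def)
    show "\<exists>c. \<forall>k\<in>{1..?N}. \<bar>g b k - c\<bar> \<le> K_const G" for b
    proof -
      obtain c where "\<And>k. k \<in> {1..?N} \<Longrightarrow> \<bar>g b k - c\<bar> \<le> K_const G"
        using simplex_subgradient_bounded_up_to_shift[OF G Delta_hat_feasible[OF G] block_strategy(1)[OF G]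
            block_strategy(2)[OF G] sub] by blast
      then show ?thesis by blast
    qed
  qed simp
  finally show ?thesis .
qed

section \<open>The regret bound\<close>

text \<open>Deterministic: all randomness is in the bounds assumed for the deviations in the blocks and for
  the reward shortfall.\<close>
lemma regret_on_good_event:
  assumes G: "valid_game G" and L: "lipschitz_const G L" and rt: "subgradient_selection G rt" and \<eta>: "\<eta> > 0"
    and n: "length h = n" "n \<ge> 1" and m: "m \<ge> 1"
    and out: "\<And>t. t \<in> {1..n} \<Longrightarrow> outcome_at h t \<in> {1..num_outcomes G}"
    and dev: "\<And>b. b < n div m \<Longrightarrow> norm (deviation G (block m b) h) \<le> real m * \<epsilon>" and \<epsilon>: "\<epsilon> \<ge> 0"
    and short: "reward_shortfall G (forecaster G rt m \<eta>) h \<le> u"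
  shows "regret G h \<le> 2 * L * \<epsilon> + real m * ln (real (num_actions G)) / (real n * \<eta>)
    + (K_const G)\<^sup>2 * \<eta> / 2 + real m / real n + u / real n"
proof -
  let ?N = "num_actions G"
  define B where "B = n div m"
  have Bm: "B * m \<le> n" by (simp add: B_def)
  have rest: "real n - real (B * m) \<le> real m"
  proof -
    have "n < B * m + m" using div_mult_mod_eq[of n m] mod_less_divisor[of m n] m unfolding B_def by linarith
    then have "real n \<le> real (B * m + m)" by (intro of_nat_mono) simp
    then show ?thesis by simp
  qed
  define p where "p b = block_strategy G rt m \<eta> (signal_at h) b" for b
  define \<Delta> where "\<Delta> b = mixed_feedback G (round_average (block m b) h)" for b
  define D where "D b = Delta_hat G m (signal_at h) b" for b
  have pS: "p b \<in> prob_simplex ?N" for b using block_strategy[OF G] by (simp add: p_def)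
  have sub: "block m b \<subseteq> {1..n}" if "b < B" for b using block_subset[OF that Bm] .
  have avgS: "round_average (block m b) h \<in> prob_simplex (num_outcomes G)"
    and avg_reward: "real m * mixed_reward G q (round_average (block m b) h) =
      (\<Sum>t\<in>block m b. mixed_reward G q (point (outcome_at h t)))" if b: "b < B" for b q
  proof -
    have out_block: "outcome_at h t \<in> {1..num_outcomes G}" if "t \<in> block m b" for t
      using out sub[OF b] that by blast
    note avg = round_average(1,3)[OF finite_block block_nonempty[OF m] out_block]
    show "round_average (block m b) h \<in> prob_simplex (num_outcomes G)" by (rule avg(1))
    show "real m * mixed_reward G q (round_average (block m b) h) =
        (\<Sum>t\<in>block m b. mixed_reward G q (point (outcome_at h t)))"
      using m by (simp add: avg(2))
  qed
  have feas: "\<Delta> b \<in> feasible G" if "b < B" for b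
    using avgS[OF that] by (auto simp: \<Delta>_def feasible_def)
  have D: "D b \<in> feasible G" for b using Delta_hat_feasible[OF G] by (simp add: D_def)
  have L0: "L \<ge> 0" using L pS[of 0] unfolding lipschitz_const_def by (blast dest: lipschitz_on_nonneg)
  have lip: "\<bar>rho G q (D b) - rho G q (\<Delta> b)\<bar> \<le> L * \<epsilon>" if b: "b < B" and q: "q \<in> prob_simplex ?N" for b q
  proof -
    have "dist (D b) (\<Delta> b) \<le> norm (deviation G (block m b) h) / real m"
      unfolding D_def \<Delta>_def using sub[OF b] out n by (intro Delta_hat_error[OF G m]) auto
    also have "\<dots> \<le> \<epsilon>" using dev[of b] b m by (simp add: B_def field_simps)
    finally have "dist (D b) (\<Delta> b) \<le> \<epsilon>" .
    moreover have "dist (rho G q (D b)) (rho G q (\<Delta> b)) \<le> L * dist (D b) (\<Delta> b)"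
      using L q D feas[OF b] unfolding lipschitz_const_def by (blast dest: lipschitz_onD)
    ultimately show ?thesis using L0 unfolding dist_real_def by (smt (verit) mult_left_mono)
  qed
  let ?R = "\<Sum>t=1..n. reward G (action_at h t) (outcome_at h t)"
  let ?E = "expected_reward G (forecaster G rt m \<eta>) h"
  have E_nonneg: "?E t \<ge> 0" if t: "t \<in> {1..n}" for t
  proof -
    have "t \<in> block m ((t - 1) div m)"
    proof -
      have "(t - 1) div m * m \<le> t - 1" "t - 1 < (t - 1) div m * m + m"
        using div_mult_mod_eq[of "t - 1" m] mod_less_divisor[of m "t - 1"] m by linarith+
      moreover have "((t - 1) div m + 1) * m = (t - 1) div m * m + m" by (simp add: add_mult_distrib)
      ultimately show ?thesis using t unfolding block_def atLeastAtMost_iff by linarith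
    qed
    then have "?E t = mixed_reward G (p ((t - 1) div m)) (point (outcome_at h t))"
      unfolding p_def using t n by (intro expected_reward_forecaster G out) auto
    then show ?thesis using mixed_reward_bounds(1)[OF G pS point_in_prob_simplex[OF out[OF t]]] by simp
  qed
  have "real m * (\<Sum>b<B. rho G (p b) (\<Delta> b)) = (\<Sum>b<B. real m * rho G (p b) (\<Delta> b))"
    by (simp add: sum_distrib_left)
  also have "\<dots> \<le> (\<Sum>b<B. \<Sum>t\<in>block m b. ?E t)"
  proof (rule sum_mono)
    fix b assume "b \<in> {..<B}"
    then have b: "b < B" by simp
    have "real m * rho G (p b) (\<Delta> b) \<le> real m * mixed_reward G (p b) (round_average (block m b) h)"
      using avgS[OF b] by (intro mult_left_mono rho_le) (auto simp: \<Delta>_def)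
    also have "\<dots> = (\<Sum>t\<in>block m b. ?E t)"
      unfolding avg_reward[OF b] p_def using sub[OF b] out n
      by (intro sum.cong refl expected_reward_forecaster[symmetric] G) auto
    finally show "real m * rho G (p b) (\<Delta> b) \<le> (\<Sum>t\<in>block m b. ?E t)" .
  qed
  also have "\<dots> = (\<Sum>t=1..B * m. ?E t)" by (rule sum_blocks[symmetric])
  \<comment> \<open>the rewards of the incomplete block are dropped\<close>
  also have "\<dots> \<le> (\<Sum>t=1..n. ?E t)" using Bm E_nonneg by (intro sum_mono2) auto
  also have "\<dots> \<le> ?R + u" using short n by (simp add: reward_shortfall_def sum_subtractf)
  finally have played: "real m * (\<Sum>b<B. rho G (p b) (\<Delta> b)) \<le> ?R + u" .
  have main: "real n * rho G y (mixed_feedback G (empirical h)) - ?R \<le>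
      real n * (2 * L * \<epsilon> + real m * ln (real ?N) / (real n * \<eta>) + (K_const G)\<^sup>2 * \<eta> / 2 + real m / real n + u / real n)"
    if y: "y \<in> prob_simplex ?N" for y
  proof -
    have "real n * rho G y (mixed_feedback G (empirical h))
        \<le> real m * (\<Sum>b<B. rho G y (\<Delta> b)) + (real n - real (B * m))"
      unfolding \<Delta>_def using rho_block_convexity[OF G y, of h m B] n m Bm out by simp
    moreover have "(\<Sum>b<B. rho G y (\<Delta> b)) - (\<Sum>b<B. rho G (p b) (\<Delta> b))
        \<le> ln (real ?N) / \<eta> + real B * ((K_const G)\<^sup>2 * \<eta> / 2) + real B * (2 * L * \<epsilon>)"
    proof -
      have "(\<Sum>b<B. rho G y (\<Delta> b)) - (\<Sum>b<B. rho G (p b) (\<Delta> b)) = (\<Sum>b<B. rho G y (\<Delta> b) - rho G (p b) (\<Delta> b))"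
        by (simp add: sum_subtractf)
      also have "\<dots> \<le> (\<Sum>b<B. (rho G y (D b) - rho G (p b) (D b)) + 2 * L * \<epsilon>)"
      proof (rule sum_mono)
        fix b assume "b \<in> {..<B}"
        then have "b < B" by simp
        from lip[OF this y] lip[OF this pS[of b]]
        show "rho G y (\<Delta> b) - rho G (p b) (\<Delta> b) \<le> (rho G y (D b) - rho G (p b) (D b)) + 2 * L * \<epsilon>"
          by (simp add: abs_le_iff)
      qed
      also have "\<dots> = (\<Sum>b<B. rho G y (D b) - rho G (p b) (D b)) + real B * (2 * L * \<epsilon>)"
        by (simp add: sum.distrib)
      finally show ?thesis using estimated_rho_regret[OF G rt \<eta> y, where B = B and m = m and s = "signal_at h"]
        unfolding p_def D_def by linarith
    qed
    then have "real m * ((\<Sum>b<B. rho G y (\<Delta> b)) - (\<Sum>b<B. rho G (p b) (\<Delta> b)))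
        \<le> real m * (ln (real ?N) / \<eta> + real B * ((K_const G)\<^sup>2 * \<eta> / 2) + real B * (2 * L * \<epsilon>))"
      by (intro mult_left_mono) auto
    moreover have "\<dots> = real m * ln (real ?N) / \<eta> + real (B * m) * ((K_const G)\<^sup>2 * \<eta> / 2 + 2 * L * \<epsilon>)"
      by (simp add: algebra_simps)
    moreover have "real (B * m) * ((K_const G)\<^sup>2 * \<eta> / 2 + 2 * L * \<epsilon>) \<le> real n * ((K_const G)\<^sup>2 * \<eta> / 2 + 2 * L * \<epsilon>)"
      using Bm L0 \<epsilon> \<eta> by (intro mult_right_mono of_nat_mono) auto
    moreover have "real n * (2 * L * \<epsilon> + real m * ln (real ?N) / (real n * \<eta>) + (K_const G)\<^sup>2 * \<eta> / 2 + real m / real n + u / real n)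
        = real m * ln (real ?N) / \<eta> + real n * ((K_const G)\<^sup>2 * \<eta> / 2 + 2 * L * \<epsilon>) + real m + u"
      using n(2) \<eta> by (simp add: field_simps)
    ultimately show ?thesis using played rest by (simp only: right_diff_distrib)
  qed
  have "(SUP y\<in>prob_simplex ?N. rho G y (mixed_feedback G (empirical h)))
      \<le> (2 * L * \<epsilon> + real m * ln (real ?N) / (real n * \<eta>) + (K_const G)\<^sup>2 * \<eta> / 2 + real m / real n + u / real n) + ?R / real n"
  proof (rule cSUP_least)
    show "prob_simplex ?N \<noteq> {}" using pS by blast
    fix y assume "y \<in> prob_simplex ?N"
    from main[OF this] show "rho G y (mixed_feedback G (empirical h)) \<le>
      (2 * L * \<epsilon> + real m * ln (real ?N) / (real n * \<eta>) + (K_const G)\<^sup>2 * \<eta> / 2 + real m / real n + u / real n) + ?R / real n"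
    proof -
      fix X assume "real n * rho G y (mixed_feedback G (empirical h)) - ?R \<le> real n * X"
      then have "real n * rho G y (mixed_feedback G (empirical h)) \<le> real n * (X + ?R / real n)"
        using n(2) by (simp add: distrib_left)
      then show "rho G y (mixed_feedback G (empirical h)) \<le> X + ?R / real n" using n(2) by simp
    qed
  qed
  then show ?thesis unfolding regret_def n(1) by simp
qed

lemma lipschitz_const_nonneg: "valid_game G \<Longrightarrow> lipschitz_const G L \<Longrightarrow> L \<ge> 0"
  unfolding lipschitz_const_def valid_game_def
  using prob_simplex_nonempty lipschitz_on_nonneg by blast

text \<open>A union bound over one deviation event for each of the \<open>n div m\<close> full blocks and one shortfall event.\<close>
lemma regret_bound_high_probability:
  fixes G :: "('s::finite) game"
  assumes G: "valid_game G" and L: "lipschitz_const G L" and rt: "subgradient_selection G rt"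
    and env: "environment G env" and n: "n \<ge> 1" and m: "m \<ge> 1" and \<eta>: "\<eta> > 0" and \<delta>: "\<delta> > 0"
  shows "measure_pmf.prob (play G env (forecaster G rt m \<eta>) n)
     {h. regret G h \<le>
           2 * sqrt 2 * L * (1 / sqrt (real m)) * sqrt (ln (2 / \<delta>))
           + real m * ln (real (num_actions G)) / (real n * \<eta>)
           + (K_const G)\<^sup>2 * \<eta> / 2
           + real m / real n
           + sqrt (1 / (2 * real n) * ln (1 / \<delta>))}
     \<ge> 1 - (real n / real m + 1) * \<delta>" (is "measure_pmf.prob ?P {h. regret G h \<le> ?bound} \<ge> _")
proof (cases "\<delta> < 1")
  case False
  then have "1 * 1 \<le> (real n / real m + 1) * \<delta>" by (intro mult_mono) auto
  then have "1 - (real n / real m + 1) * \<delta> \<le> 0" by simp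
  also have "0 \<le> measure_pmf.prob ?P {h. regret G h \<le> ?bound}" by simp
  finally show ?thesis .
next
  case True
  let ?fc = "forecaster G rt m \<eta>"
  define B where "B = n div m"
  define \<epsilon> where "\<epsilon> = sqrt (2 * real m * ln (2 / \<delta>)) / real m"
  define u where "u = sqrt (real n * ln (1 / \<delta>) / 2)"
  define bad where "bad b = {h. norm (deviation G (block m b) h) > sqrt (2 * real m * ln (2 / \<delta>))}" for b
  define short where "short = {h. reward_shortfall G ?fc h > u}"
  have "ln (2 / \<delta>) \<ge> 0" using True \<delta> by simp
  then have \<epsilon>0: "\<epsilon> \<ge> 0" by (simp add: \<epsilon>_def)
  have bound: "?bound = 2 * L * \<epsilon> + real m * ln (real (num_actions G)) / (real n * \<eta>)
      + (K_const G)\<^sup>2 * \<eta> / 2 + real m / real n + u / real n"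
  proof -
    have "\<epsilon> = sqrt 2 * (1 / sqrt (real m)) * sqrt (ln (2 / \<delta>))"
    proof -
      have "sqrt (real m) / real m = 1 / sqrt (real m)"
        using m by (simp add: field_simps)
      moreover have "\<epsilon> = sqrt 2 * (sqrt (real m) / real m) * sqrt (ln (2 / \<delta>))"
        by (simp add: \<epsilon>_def real_sqrt_mult)
      ultimately show ?thesis by simp
    qed
    moreover have "u / real n = sqrt (1 / (2 * real n) * ln (1 / \<delta>))"
    proof -
      have "u / real n = sqrt (real n * ln (1 / \<delta>) / 2) / sqrt ((real n)\<^sup>2)" by (simp add: u_def)
      also have "\<dots> = sqrt (real n * ln (1 / \<delta>) / 2 / (real n)\<^sup>2)" by (rule real_sqrt_divide[symmetric])
      also have "real n * ln (1 / \<delta>) / 2 / (real n)\<^sup>2 = 1 / (2 * real n) * ln (1 / \<delta>)"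
        using n by (simp add: power2_eq_square)
      finally show ?thesis .
    qed
    ultimately show ?thesis by simp
  qed
  have good: "h \<in> {h. regret G h \<le> ?bound} \<union> ((\<Union>b<B. bad b) \<union> short)" if h: "h \<in> set_pmf ?P" for h
  proof -
    have "regret G h \<le> ?bound" if "\<And>b. b < B \<Longrightarrow> h \<notin> bad b" "h \<notin> short"
      unfolding bound
    proof (rule regret_on_good_event[OF G L rt \<eta> length_play[OF h] n m])
      show "outcome_at h t \<in> {1..num_outcomes G}" if "t \<in> {1..n}" for t
        using play_outcome_range[OF env h] length_play[OF h] that by simp
      show "norm (deviation G (block m b) h) \<le> real m * \<epsilon>" if "b < n div m" for b
        using \<open>\<And>b. b < B \<Longrightarrow> h \<notin> bad b\<close>[of b] that m by (simp add: bad_def B_def \<epsilon>_def)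
      show "reward_shortfall G ?fc h \<le> u" using \<open>h \<notin> short\<close> by (simp add: short_def)
    qed (rule \<epsilon>0)
    then show ?thesis by blast
  qed
  have "1 = measure_pmf.prob ?P (set_pmf ?P)"
    by (simp add: measure_pmf.prob_eq_1 AE_measure_pmf_iff)
  also have "\<dots> \<le> measure_pmf.prob ?P ({h. regret G h \<le> ?bound} \<union> ((\<Union>b<B. bad b) \<union> short))"
    using good by (intro measure_pmf.finite_measure_mono) auto
  also have "\<dots> \<le> measure_pmf.prob ?P {h. regret G h \<le> ?bound} + measure_pmf.prob ?P ((\<Union>b<B. bad b) \<union> short)"
    by (rule measure_Un_le) auto
  also have "measure_pmf.prob ?P ((\<Union>b<B. bad b) \<union> short) \<le> measure_pmf.prob ?P (\<Union>b<B. bad b) + measure_pmf.prob ?P short"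
    by (rule measure_Un_le) auto
  also have "measure_pmf.prob ?P (\<Union>b<B. bad b) \<le> (\<Sum>b<B. measure_pmf.prob ?P (bad b))"
    by (rule measure_UNION_le) auto
  also have "\<dots> \<le> (\<Sum>b<B. \<delta>)"
  proof (rule sum_mono)
    fix b assume "b \<in> {..<B}"
    then have "block m b \<subseteq> {1..n}" by (intro block_subset[of b B]) (auto simp: B_def)
    from deviation_tail[OF this card_block m \<delta> True]
    show "measure_pmf.prob ?P (bad b) \<le> \<delta>" by (simp add: bad_def)
  qed
  also have "measure_pmf.prob ?P short \<le> \<delta>"
    unfolding short_def u_def by (rule reward_shortfall_tail[OF G env set_forecaster[OF G] n \<delta> True])
  finally have "1 \<le> measure_pmf.prob ?P {h. regret G h \<le> ?bound} + (real B + 1) * \<delta>"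
    by (simp add: distrib_right)
  moreover have "real B \<le> real n / real m" unfolding B_def by (rule of_nat_div_le_of_nat)
  then have "(real B + 1) * \<delta> \<le> (real n / real m + 1) * \<delta>" using \<delta> by (intro mult_right_mono) auto
  ultimately show ?thesis by linarith
qed

section \<open>Tuned parameters\<close>

text \<open>With one action there is no choice, and the collected reward is the mean reward under the empirical
  outcome law, which is a candidate in the minimum defining \<open>rho\<close>.\<close>
lemma single_action_regret:
  assumes G: "valid_game G" and N: "num_actions G = 1" and env: "environment G env"
    and n: "n \<ge> 1" and h: "h \<in> set_pmf (play G env fc n)"
    and fc: "\<And>h. set_pmf (fc h) \<subseteq> {1..num_actions G}"
  shows "regret G h \<le> 0"
proof -
  have len: "length h = n" using h by (rule length_play)
  have out: "outcome_at h t \<in> {1..num_outcomes G}" if "t \<in> {1..n}" for t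
    using play_outcome_range[OF env h] len that by simp
  have act: "action_at h t = 1" if "t \<in> {1..n}" for t
  proof -
    have "h \<in> set_pmf (play G env fc k) \<Longrightarrow> t \<in> {1..k} \<Longrightarrow> action_at h t = 1" for k
    proof (induction k arbitrary: h)
      case (Suc k)
      then obtain h' j i s where h': "h' \<in> set_pmf (play G env fc k)" "i \<in> set_pmf (fc h')" "h = h' @ [(j, i, s)]"
        by auto
      have "length h' = k" using h'(1) by (rule length_play)
      then show ?case using Suc.IH[OF h'(1)] Suc.prems(2) h'(2,3) fc[of h'] N
        by (cases "t \<le> k") (auto simp: action_at_def nth_append)
    qed simp
    then show ?thesis using h that by blast
  qed
  have avg: "empirical h \<in> prob_simplex (num_outcomes G)"
    "mixed_reward G p (empirical h) = (1 / real n) * (\<Sum>t=1..n. mixed_reward G p (point (outcome_at h t)))" for p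
    using round_average(1,3)[of "{1..n}" h G] out n unfolding empirical_eq_round_average len by auto
  have "(SUP p\<in>prob_simplex (num_actions G). rho G p (mixed_feedback G (empirical h)))
      \<le> (1 / real n) * (\<Sum>t=1..n. reward G (action_at h t) (outcome_at h t))"
  proof (rule cSUP_least)
    show "prob_simplex (num_actions G) \<noteq> {}"
      using prob_simplex_nonempty[of "num_actions G"] N by auto
    fix p assume p: "p \<in> prob_simplex (num_actions G)"
    then have "p 1 = 1" using N by (simp add: prob_simplex_def)
    then have "mixed_reward G p (point (outcome_at h t)) = reward G (action_at h t) (outcome_at h t)"
      if "t \<in> {1..n}" for t
      using mixed_reward_point[OF out[OF that], of p] act[OF that] N by simp
    then show "rho G p (mixed_feedback G (empirical h))
        \<le> (1 / real n) * (\<Sum>t=1..n. reward G (action_at h t) (outcome_at h t))"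
      using rho_le[OF avg(1) refl, of p] unfolding avg(2) by simp
  qed
  then show ?thesis unfolding regret_def len by simp
qed

text \<open>All terms are compared with \<open>n powr (- 1 / 4) * sqrt X\<close>, where \<open>X = ln (n * N / \<delta>)\<close>. For \<open>N \<ge> 2\<close> this
  \<open>X\<close> is at least \<open>ln 2\<close>, so constants are absorbed, and \<open>2 / \<delta>' \<le> (n * N / \<delta>) ^ 2\<close> replaces the logarithms of
  the single events by \<open>2 * X\<close>. The contributions to the constant are those of the five summands, in order,
  with 4 and 1 for the last two.\<close>
lemma tuned_bound:
  fixes \<delta> L K c :: real
  assumes n: "n \<ge> 1" and N: "N \<ge> 2" and m: "m = nat \<lceil>sqrt (real n)\<rceil>"
    and c: "c > 0" and \<eta>: "\<eta> = c * sqrt (real m * ln (real N) / real n)"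
    and \<delta>: "0 < \<delta>" "\<delta> < 1" and L: "L \<ge> 0"
    and \<delta>': "\<delta>' = \<delta> / (real n / real m + 1)"
  shows "2 * sqrt 2 * L * (1 / sqrt (real m)) * sqrt (ln (2 / \<delta>')) + real m * ln (real N) / (real n * \<eta>)
      + K\<^sup>2 * \<eta> / 2 + real m / real n + sqrt (1 / (2 * real n) * ln (1 / \<delta>'))
    \<le> (4 * L + sqrt 2 / c + sqrt 2 * c * K\<^sup>2 / 2 + 5) * real n powr (- 1 / 4)
        * sqrt (ln (real n * real N / \<delta>))"
proof -
  define X where "X = ln (real n * real N / \<delta>)"
  define a where "a = real n powr (- 1 / 4)"
  define r where "r = sqrt (real n)"
  have r1: "r \<ge> 1" and rr: "r * r = real n" using n by (simp_all add: r_def)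
  have m_ge: "r \<le> real m" unfolding m r_def by linarith
  have m_le: "real m \<le> 2 * r"
  proof -
    have "real m \<le> r + 1" unfolding m r_def by (simp add: of_nat_nat)
    then show ?thesis using r1 by simp
  qed
  have m_over_n: "real m / real n \<le> 2 * (1 / r)"
  proof -
    have "real m / (r * r) \<le> 2 * r / (r * r)" using m_le by (intro divide_right_mono) auto
    also have "\<dots> = 2 * (1 / r)" using r1 by simp
    finally show ?thesis by (simp only: rr)
  qed
  have m0: "real m > 0" using m_ge r1 by linarith
  have a0: "a > 0" unfolding a_def using n by simp
  have aa: "a * a = 1 / r"
  proof -
    have "a * a = real n powr (- 1 / 4 + - 1 / 4)" unfolding a_def by (rule powr_add[symmetric])
    also have "(- 1 / 4 + - 1 / 4 :: real) = - (1 / 2)" by simp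
    also have "real n powr (- (1 / 2)) = inverse (real n powr (1 / 2))" by (rule powr_minus)
    also have "real n powr (1 / 2) = r" using n by (simp add: r_def powr_half_sqrt)
    finally show ?thesis by (simp only: inverse_eq_divide)
  qed
  have sqrt_r: "sqrt (1 / r) = a" unfolding aa[symmetric] using a0 by simp
  have r_le_a: "1 / r \<le> a"
  proof -
    have "a \<le> 1" unfolding a_def using n powr_mono[of "- 1 / 4" 0 "real n"] by simp
    then show ?thesis using aa a0 mult_left_mono[of a 1 a] by simp
  qed
  have nN: "real n * real N \<ge> 2" using n N mult_mono[of 1 "real n" 2 "real N"] by simp
  then have arg: "real n * real N / \<delta> \<ge> 2" 
  proof -
    have "2 * \<delta> \<le> real n * real N" using nN \<delta> by linarith
    then show ?thesis using \<delta> by (simp add: le_divide_eq)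
  qed
  have X_ln2: "X \<ge> ln 2" unfolding X_def using arg by simp
  have "ln 2 \<ge> (1 / 2 :: real)" using ln2_ge_two_thirds by simp
  with X_ln2 have X: "X \<ge> 1 / 2" by linarith
  have sX: "sqrt X \<ge> 1 / 2"
  proof -
    have "sqrt X \<ge> sqrt ((1 / 2)\<^sup>2)" using X by (intro real_sqrt_le_mono) (simp add: power2_eq_square)
    then show ?thesis by simp
  qed
  have lnN: "0 \<le> ln (real N)" "ln (real N) \<le> X" "ln (real N) > 0"
  proof -
    have "1 \<le> real n / \<delta>" using n \<delta> by (simp add: le_divide_eq)
    then have "1 * real N \<le> real n / \<delta> * real N" by (intro mult_right_mono) auto
    then show "ln (real N) \<le> X" unfolding X_def using N by (subst ln_le_cancel_iff) auto
  qed (use N in auto)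
  have ratio: "real n / real m \<le> r" 
  proof -
    have "r * r \<le> r * real m" using m_ge r1 by (intro mult_left_mono) auto
    then show ?thesis using m0 rr by (simp add: divide_le_eq)
  qed
  have \<delta>'0: "\<delta>' > 0" unfolding \<delta>' using \<delta> m0 n by (intro divide_pos_pos add_nonneg_pos) auto
  have \<delta>'_ln: "ln (2 / \<delta>') \<le> 2 * X"
  proof -
    have "2 / \<delta>' = 2 * (real n / real m + 1) / \<delta>" unfolding \<delta>' by simp
    also have "\<dots> \<le> (4 * real n) / \<delta>"
    proof (intro divide_right_mono)
      have "r \<le> real n" unfolding rr[symmetric] using r1 by simp
      then have "real n / real m \<le> real n" "1 \<le> real n" using ratio r1 by linarith+
      then show "2 * (real n / real m + 1) \<le> 4 * real n" by simp
    qed (use \<delta> in simp)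
    also have "\<dots> \<le> (real n * real N / \<delta>) * (real n * real N / \<delta>)"
    proof -
      have "4 * real n \<le> (real n * real N) * (real n * real N)"
      proof -
        have "2 * 2 \<le> real N * real N" using N by (intro mult_mono) auto
        then have "(2 * 2) * (real n * 1) \<le> (real N * real N) * (real n * real n)"
          using n by - (rule mult_mono, auto)
        then show ?thesis by (simp add: mult_ac)
      qed
      moreover have "\<delta> * \<delta> \<le> \<delta>" using \<delta> by (simp add: mult_left_le)
      ultimately have "4 * real n / \<delta> \<le> (real n * real N) * (real n * real N) / (\<delta> * \<delta>)"
        using \<delta> by (intro frac_le) auto
      then show ?thesis by simp
    qed
    finally have le: "2 / \<delta>' \<le> (real n * real N / \<delta>) * (real n * real N / \<delta>)" .
    have pos: "0 < real n * real N / \<delta>" using arg by linarith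
    have "ln (2 / \<delta>') \<le> ln ((real n * real N / \<delta>) * (real n * real N / \<delta>))"
      by (rule iffD2[OF ln_le_cancel_iff[OF _ mult_pos_pos[OF pos pos]] le]) (use \<delta>'0 in simp)
    also have "\<dots> = 2 * X" unfolding X_def ln_mult_pos[OF pos pos] by simp
    finally show ?thesis .
  qed
  have \<delta>'_ln1: "ln (1 / \<delta>') \<le> 2 * X"
  proof -
    have "ln (1 / \<delta>') \<le> ln (2 / \<delta>')" using \<delta>'0 by (simp add: divide_right_mono)
    with \<delta>'_ln show ?thesis by linarith
  qed
  have T1: "2 * sqrt 2 * L * (1 / sqrt (real m)) * sqrt (ln (2 / \<delta>')) \<le> 4 * L * (a * sqrt X)"
  proof -
    have "1 / sqrt (real m) \<le> a"
    proof -
      have "sqrt (1 / real m) \<le> sqrt (1 / r)" using m_ge r1 by (intro real_sqrt_le_mono) (simp add: frac_le)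
      then show ?thesis unfolding sqrt_r by (simp add: real_sqrt_divide)
    qed
    moreover have "sqrt (ln (2 / \<delta>')) \<le> sqrt 2 * sqrt X"
      using real_sqrt_le_mono[OF \<delta>'_ln] by (simp add: real_sqrt_mult)
    moreover have "ln (2 / \<delta>') \<ge> 0"
    proof -
      have "\<delta>' \<le> \<delta> / 1" unfolding \<delta>' using \<delta> by (intro divide_left_mono) (auto intro: add_nonneg_pos)
      then have "1 \<le> 2 / \<delta>'" using \<delta>'0 \<delta> by (simp add: le_divide_eq)
      then show ?thesis by (rule ln_ge_zero)
    qed
    ultimately have "(1 / sqrt (real m)) * sqrt (ln (2 / \<delta>')) \<le> a * (sqrt 2 * sqrt X)"
      using a0 by (intro mult_mono) auto
    then have "2 * sqrt 2 * L * ((1 / sqrt (real m)) * sqrt (ln (2 / \<delta>'))) \<le> 2 * sqrt 2 * L * (a * (sqrt 2 * sqrt X))"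
      using L by (intro mult_left_mono) auto
    also have "\<dots> = 4 * L * (a * sqrt X)" by simp
    finally show ?thesis by (simp add: mult.assoc)
  qed
  define s where "s = sqrt (real m * ln (real N) / real n)"
  have s0: "s > 0" unfolding s_def using m0 lnN n by simp
  have s_le: "s \<le> sqrt 2 * (a * sqrt X)"
  proof -
    have "real m / real n \<le> 2 / r" using m_over_n by simp
    then have "real m / real n * ln (real N) \<le> 2 / r * X"
      using lnN r1 by (intro mult_mono) auto
    then have "s \<le> sqrt (2 * (1 / r) * X)" unfolding s_def by (intro real_sqrt_le_mono) simp
    also have "\<dots> = sqrt 2 * a * sqrt X" by (simp only: real_sqrt_mult sqrt_r)
    finally show ?thesis by (simp add: mult.assoc)
  qed
  have T2: "real m * ln (real N) / (real n * \<eta>) \<le> sqrt 2 / c * (a * sqrt X)"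
  proof -
    have "s * s = real m * ln (real N) / real n" unfolding s_def using m0 lnN n by simp
    then have "real m * ln (real N) / (real n * \<eta>) = s * s / (c * s)"
      unfolding \<eta> s_def[symmetric] by (simp add: field_simps)
    also have "\<dots> = s / c" using s0 by simp
    also have "\<dots> \<le> sqrt 2 * (a * sqrt X) / c" using s_le c by (intro divide_right_mono) auto
    finally show ?thesis by simp
  qed
  have T3: "K\<^sup>2 * \<eta> / 2 \<le> sqrt 2 * c * K\<^sup>2 / 2 * (a * sqrt X)"
  proof -
    have "K\<^sup>2 * c / 2 * s \<le> K\<^sup>2 * c / 2 * (sqrt 2 * (a * sqrt X))"
      using s_le c by (intro mult_left_mono) auto
    then show ?thesis unfolding \<eta> s_def[symmetric] by (simp add: mult_ac)
  qed
  have T4: "real m / real n \<le> 4 * (a * sqrt X)"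
  proof -
    have "real m / real n \<le> 2 * (1 / r)" by (rule m_over_n)
    also have "\<dots> \<le> 2 * a" using r_le_a by simp
    also have "2 * a = 4 * (a * (1 / 2))" by simp
    also have "\<dots> \<le> 4 * (a * sqrt X)" using sX a0 by simp
    finally show ?thesis .
  qed
  have T5: "sqrt (1 / (2 * real n) * ln (1 / \<delta>')) \<le> a * sqrt X"
  proof -
    have "1 / (2 * real n) * ln (1 / \<delta>') \<le> 1 / (2 * real n) * (2 * X)"
      using \<delta>'_ln1 by (intro mult_left_mono) auto
    also have "\<dots> = (1 / r) * (1 / r) * X" by (simp add: rr)
    finally have "sqrt (1 / (2 * real n) * ln (1 / \<delta>')) \<le> sqrt ((1 / r) * (1 / r) * X)"
      by (rule real_sqrt_le_mono)
    also have "\<dots> = a * a * sqrt X" by (simp only: real_sqrt_mult sqrt_r)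
    also have "\<dots> \<le> a * sqrt X" using aa r_le_a X by (intro mult_right_mono) auto
    finally show ?thesis .
  qed
  have "(4 * L + sqrt 2 / c + sqrt 2 * c * K\<^sup>2 / 2 + 5) * a * sqrt X =
      4 * L * (a * sqrt X) + sqrt 2 / c * (a * sqrt X) + sqrt 2 * c * K\<^sup>2 / 2 * (a * sqrt X) + 4 * (a * sqrt X) + a * sqrt X"
    by (simp add: algebra_simps)
  with T1 T2 T3 T4 T5 show ?thesis unfolding X_def[symmetric] a_def[symmetric] by linarith
qed

text \<open>A game with a single action is treated apart: there \<open>\<eta> = 0\<close>, and \<open>ln (n * N / \<delta>)\<close> may be arbitrarily
  close to 0.\<close>
lemma tuned_regret_bound:
  fixes G :: "('s::finite) game"
  assumes c: "c > 0" and G: "valid_game G" and L: "lipschitz_const G L" and rt: "subgradient_selection G rt"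
    and env: "environment G env" and n: "n \<ge> 1" and m: "m = nat \<lceil>sqrt (real n)\<rceil>"
    and \<eta>: "\<eta> = c * sqrt (real m * ln (real (num_actions G)) / real n)" and \<delta>: "\<delta> > 0"
  shows "measure_pmf.prob (play G env (forecaster G rt m \<eta>) n)
     {h. regret G h \<le> (4 * L + sqrt 2 / c + sqrt 2 * c * (K_const G)\<^sup>2 / 2 + 5) * real n powr (- 1 / 4)
           * sqrt (ln (real n * real (num_actions G) / \<delta>))} \<ge> 1 - \<delta>"
    (is "measure_pmf.prob ?P {h. regret G h \<le> ?bound} \<ge> _")
proof (cases "\<delta> < 1")
  case False
  then have "1 - \<delta> \<le> 0" by simp
  also have "0 \<le> measure_pmf.prob ?P {h. regret G h \<le> ?bound}" by simp
  finally show ?thesis .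
next
  case True
  have L0: "L \<ge> 0" by (rule lipschitz_const_nonneg[OF G L])
  have N1: "num_actions G \<ge> 1" using G by (simp add: valid_game_def)
  show ?thesis
  proof (cases "num_actions G = 1")
    case True
    have "real n / \<delta> \<ge> 1" using n \<delta> \<open>\<delta> < 1\<close> by (simp add: field_simps)
    then have "?bound \<ge> 0" using True L0 c by (intro mult_nonneg_nonneg add_nonneg_nonneg) auto
    then have "set_pmf ?P \<subseteq> {h. regret G h \<le> ?bound}"
      using single_action_regret[OF G True env n _ set_forecaster[OF G]] by fastforce
    then have "measure_pmf.prob ?P {h. regret G h \<le> ?bound} = 1"
      by (auto simp: measure_pmf.prob_eq_1 AE_measure_pmf_iff)
    then show ?thesis using \<delta> by simp
  next
    case False
    then have N2: "num_actions G \<ge> 2" using N1 by simp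
    have "real m \<ge> sqrt (real n)" unfolding m by linarith
    moreover have "sqrt (real n) \<ge> 1" using n by simp
    ultimately have m1: "m \<ge> 1" by linarith
    have \<eta>0: "\<eta> > 0" unfolding \<eta> using c m1 N2 n by simp
    define \<delta>' where "\<delta>' = \<delta> / (real n / real m + 1)"
    have q: "real n / real m + 1 > 0" by (intro add_nonneg_pos) auto
    then have \<delta>'0: "\<delta>' > 0" unfolding \<delta>'_def using \<delta> by simp
    have "1 - \<delta> = 1 - (real n / real m + 1) * \<delta>'" using q by (simp add: \<delta>'_def)
    also have "\<dots> \<le> measure_pmf.prob ?P {h. regret G h \<le>
           2 * sqrt 2 * L * (1 / sqrt (real m)) * sqrt (ln (2 / \<delta>'))
           + real m * ln (real (num_actions G)) / (real n * \<eta>) + (K_const G)\<^sup>2 * \<eta> / 2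
           + real m / real n + sqrt (1 / (2 * real n) * ln (1 / \<delta>'))}"
      by (rule regret_bound_high_probability[OF G L rt env n m1 \<eta>0 \<delta>'0])
    also have "\<dots> \<le> measure_pmf.prob ?P {h. regret G h \<le> ?bound}"
      using tuned_bound[OF n N2 m c \<eta> \<delta> True L0 \<delta>'_def, of "K_const G"]
      by (intro measure_pmf.finite_measure_mono) auto
    finally show ?thesis .
  qed
qed

theorem theorem5p1:
  shows
    "(\<forall>G :: ('s::finite) game. valid_game G \<longrightarrow>
        bdd_above (subgradient_norms G) \<and> K_const G \<le> 1 \<and> (\<exists>L. lipschitz_const G L) \<and>
        (\<forall>L rt env (n::nat) (m::nat) (\<eta>::real) (\<delta>::real).
           lipschitz_const G L \<longrightarrow> subgradient_selection G rt \<longrightarrow> environment G env \<longrightarrow>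
           n \<ge> 1 \<longrightarrow> m \<ge> 1 \<longrightarrow> \<eta> > 0 \<longrightarrow> \<delta> > 0 \<longrightarrow>
           measure_pmf.prob (play G env (forecaster G rt m \<eta>) n)
             {h. regret G h \<le>
                   2 * sqrt 2 * L * (1 / sqrt (real m)) * sqrt (ln (2 / \<delta>))
                   + real m * ln (real (num_actions G)) / (real n * \<eta>)
                   + (K_const G)\<^sup>2 * \<eta> / 2
                   + real m / real n
                   + sqrt (1 / (2 * real n) * ln (1 / \<delta>))}
           \<ge> 1 - (real n / real m + 1) * \<delta>))
     \<and>
     (\<forall>c::real. c > 0 \<longrightarrow>
        (\<exists>C :: real \<Rightarrow> real \<Rightarrow> real.
           \<forall>G :: 's game. valid_game G \<longrightarrow>
             (\<forall>L rt env (n::nat) (m::nat) (\<eta>::real) (\<delta>::real).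
                lipschitz_const G L \<longrightarrow> subgradient_selection G rt \<longrightarrow> environment G env \<longrightarrow>
                n \<ge> 1 \<longrightarrow> m = nat \<lceil>sqrt (real n)\<rceil> \<longrightarrow>
                \<eta> = c * sqrt (real m * ln (real (num_actions G)) / real n) \<longrightarrow> \<delta> > 0 \<longrightarrow>
                measure_pmf.prob (play G env (forecaster G rt m \<eta>) n)
                  {h. regret G h \<le>
                        C (K_const G) L * real n powr (- 1 / 4)
                        * sqrt (ln (real n * real (num_actions G) / \<delta>))}
                \<ge> 1 - \<delta>)))"
proof (intro conjI allI impI)
  fix G :: "('s::finite) game"
  assume G: "valid_game G"
  then show "bdd_above (subgradient_norms G)" "K_const G \<le> 1" "\<exists>L. lipschitz_const G L"
    by (rule bdd_above_subgradient_norms, rule K_const_le_1, rule lipschitz_const_exists)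
next
  fix c :: real
  assume c: "c > 0"
  show "\<exists>C :: real \<Rightarrow> real \<Rightarrow> real. \<forall>G :: 's game. valid_game G \<longrightarrow>
      (\<forall>L rt env (n::nat) (m::nat) (\<eta>::real) (\<delta>::real).
         lipschitz_const G L \<longrightarrow> subgradient_selection G rt \<longrightarrow> environment G env \<longrightarrow>
         n \<ge> 1 \<longrightarrow> m = nat \<lceil>sqrt (real n)\<rceil> \<longrightarrow>
         \<eta> = c * sqrt (real m * ln (real (num_actions G)) / real n) \<longrightarrow> \<delta> > 0 \<longrightarrow>
         measure_pmf.prob (play G env (forecaster G rt m \<eta>) n)
           {h. regret G h \<le> C (K_const G) L * real n powr (- 1 / 4)
                 * sqrt (ln (real n * real (num_actions G) / \<delta>))} \<ge> 1 - \<delta>)"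
    by (intro exI[of _ "\<lambda>K L. 4 * L + sqrt 2 / c + sqrt 2 * c * K\<^sup>2 / 2 + 5"] allI impI)
      (rule tuned_regret_bound[OF c])
qed (rule regret_bound_high_probability)

end
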